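(* Let $\mathbb{K}$ be a field of characteristic $0$, let $n\geq 1$, and let $\mathcal{D}_2$ be the $\mathbb{K}$-linear derivation of the polynomial algebra $\mathbb{K}[X,Y,Z]=\mathbb{K}[x_1,\ldots,x_n,y_1,\ldots,y_n,z_1,\ldots,z_n]$ in $3n$ variables defined by $$\mathcal{D}_2(x_i)=0,\qquad \mathcal{D}_2(y_i)=x_i,\qquad \mathcal{D}_2(z_i)=y_i,\qquad i=1,\ldots,n.$$ Then the kernel $\ker\mathcal{D}_2$ is generated as a $\mathbb{K}$-algebra by the elements of the following types: 1. $x_1,x_2,\ldots,x_n$; 2. $J_{i,j}:=\begin{vmatrix} x_i & x_j\\ y_i & y_j\end{vmatrix}$, $1\leq i<j\leq n$; 3. $H_{i,j}:=x_iz_j-y_iy_j+z_ix_j$, $1\leq i\leq j\leq n$; 4. $\Delta_{i,j,k}:=\begin{vmatrix} x_i & x_j & x_k\\ y_i & y_j & y_k\\ z_i & z_j & z_k\end{vmatrix}$, $1\leq i<j<k\leq n$.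
   Context: For a derivation $\mathcal{D}$ of a $\mathbb{K}$-algebra $A$, $\ker\mathcal{D}=\{f\in A : \mathcal{D}(f)=0\}$, which is a $\mathbb{K}$-subalgebra of $A$. *)

theory Defs
  imports "HOL-Analysis.Determinants" "HOL-Library.Poly_Mapping"
begin

datatype pvar = X nat | Y nat | Z nat

text \<open>A polynomial maps monomials (finitely supported exponent vectors) to coefficients;
  the product of \<^theory>\<open>HOL-Library.Poly_Mapping\<close> is then polynomial multiplication.\<close>

type_synonym 'k mpoly = "(pvar \<Rightarrow>\<^sub>0 nat) \<Rightarrow>\<^sub>0 'k"

definition Const :: "'k::zero \<Rightarrow> 'k mpoly" where
  "Const c = Poly_Mapping.single 0 c"

definition Var :: "pvar \<Rightarrow> 'k::zero_neq_one mpoly" where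
  "Var v = Poly_Mapping.single (Poly_Mapping.single v 1) 1"

definition pvars_upto :: "nat \<Rightarrow> pvar set" where
  "pvars_upto n = X ` {1..n} \<union> Y ` {1..n} \<union> Z ` {1..n}"

text \<open>The polynomial algebra in \<open>3n\<close> variables is the set of those polynomials that involve
  only variables with index in \<open>{1..n}\<close>.\<close>

definition poly_algebra :: "nat \<Rightarrow> 'k::zero mpoly set" where
  "poly_algebra n = {p. \<forall>m \<in> Poly_Mapping.keys p. Poly_Mapping.keys m \<subseteq> pvars_upto n}"

text \<open>Scalar multiplication by \<open>c\<close> is multiplication by \<open>Const c\<close>, so closure under scalar
  multiples, zero, one and negation is included.\<close>

definition subalgebra :: "'k::comm_ring_1 mpoly set \<Rightarrow> bool" where
  "subalgebra A \<longleftrightarrow>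
     (\<forall>c. Const c \<in> A) \<and> (\<forall>p\<in>A. \<forall>q\<in>A. p + q \<in> A) \<and> (\<forall>p\<in>A. \<forall>q\<in>A. p * q \<in> A)"

definition derivation_on ::
    "'k::comm_ring_1 mpoly set \<Rightarrow> ('k mpoly \<Rightarrow> 'k mpoly) \<Rightarrow> bool" where
  "derivation_on A D \<longleftrightarrow>
     (\<forall>p\<in>A. D p \<in> A) \<and>
     (\<forall>p\<in>A. \<forall>q\<in>A. D (p + q) = D p + D q) \<and>
     (\<forall>c. \<forall>p\<in>A. D (Const c * p) = Const c * D p) \<and>
     (\<forall>p\<in>A. \<forall>q\<in>A. D (p * q) = D p * q + p * D q)"

definition kernel_on :: "'k::zero mpoly set \<Rightarrow> ('k mpoly \<Rightarrow> 'k mpoly) \<Rightarrow> 'k mpoly set" where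
  "kernel_on A D = {p \<in> A. D p = 0}"

definition J :: "nat \<Rightarrow> nat \<Rightarrow> 'k::comm_ring_1 mpoly" where
  "J i j = det (vector [vector [Var (X i), Var (X j)],
                        vector [Var (Y i), Var (Y j)]] :: ('k mpoly)^2^2)"

definition H :: "nat \<Rightarrow> nat \<Rightarrow> 'k::comm_ring_1 mpoly" where
  "H i j = Var (X i) * Var (Z j) - Var (Y i) * Var (Y j) + Var (Z i) * Var (X j)"

definition Delta :: "nat \<Rightarrow> nat \<Rightarrow> nat \<Rightarrow> 'k::comm_ring_1 mpoly" where
  "Delta i j k = det (vector [vector [Var (X i), Var (X j), Var (X k)],
                              vector [Var (Y i), Var (Y j), Var (Y k)],
                              vector [Var (Z i), Var (Z j), Var (Z k)]] :: ('k mpoly)^3^3)"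


section \<open>Existence of the derivation determined by its values on the variables\<close>

lemma Const_in_poly_algebra: "Const c \<in> poly_algebra n"
  by (auto simp: poly_algebra_def Const_def)

lemma zero_in_poly_algebra: "0 \<in> poly_algebra n"
  by (simp add: poly_algebra_def)

lemma add_in_poly_algebra:
  fixes p q :: "'k::comm_ring_1 mpoly"
  assumes "p \<in> poly_algebra n" "q \<in> poly_algebra n"
  shows "p + q \<in> poly_algebra n"
  using assms keys_add[of p q] by (fastforce simp: poly_algebra_def)

lemma mult_in_poly_algebra:
  fixes p q :: "'k::comm_ring_1 mpoly"
  assumes "p \<in> poly_algebra n" "q \<in> poly_algebra n"
  shows "p * q \<in> poly_algebra n"
  unfolding poly_algebra_def
proof safe
  fix m v assume m: "m \<in> Poly_Mapping.keys (p * q)" and v: "v \<in> Poly_Mapping.keys m"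
  obtain a b where "m = a + b" "a \<in> Poly_Mapping.keys p" "b \<in> Poly_Mapping.keys q"
    using keys_mult[of p q] m by blast
  then show "v \<in> pvars_upto n"
    using assms v keys_add[of a b] by (fastforce simp: poly_algebra_def)
qed

lemma subalgebra_poly_algebra: "subalgebra (poly_algebra n)"
  by (auto simp: subalgebra_def Const_in_poly_algebra add_in_poly_algebra mult_in_poly_algebra)

lemma Var_in_poly_algebra: "v \<in> pvars_upto n \<Longrightarrow> Var v \<in> poly_algebra n"
  by (auto simp: poly_algebra_def Var_def)

lemma sum_in_poly_algebra:
  fixes f :: "'i \<Rightarrow> 'k::comm_ring_1 mpoly"
  assumes "\<And>i. i \<in> I \<Longrightarrow> f i \<in> poly_algebra n"
  shows "sum f I \<in> poly_algebra n"
  using assms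
  by (induction I rule: infinite_finite_induct)
     (auto intro: zero_in_poly_algebra add_in_poly_algebra)

lemma mpoly_induct [case_names single add]:
  fixes p :: "'k::comm_ring_1 mpoly"
  assumes single: "\<And>m c. P (Poly_Mapping.single m c)"
    and add: "\<And>p q. P p \<Longrightarrow> P q \<Longrightarrow> P (p + q)"
  shows "P p"
proof (induction p rule: update_induct)
  case const
  show ?case using single[of 0 0] by simp
next
  case (update f a b)
  have "Poly_Mapping.update a b f = f + Poly_Mapping.single a b"
    using update(1)
    by (intro poly_mapping_eqI)
       (auto simp: lookup_update lookup_add lookup_single when_def in_keys_iff)
  with update show ?case by (simp add: add single)
qed

definition pd :: "pvar \<Rightarrow> 'k::comm_ring_1 mpoly \<Rightarrow> 'k mpoly" where
  "pd v p = (\<Sum>m\<in>Poly_Mapping.keys p.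
     Poly_Mapping.single (m - Poly_Mapping.single v 1)
       (Poly_Mapping.lookup p m * of_nat (Poly_Mapping.lookup m v)))"

lemma pd_add: "pd v (p + q) = pd v p + pd v q"
  unfolding pd_def
  by (rule setsum_keys_plus_distrib) (simp_all add: single_add distrib_right)

lemma pd_single:
  "pd v (Poly_Mapping.single m c) =
     Poly_Mapping.single (m - Poly_Mapping.single v 1) (c * of_nat (Poly_Mapping.lookup m v))"
  by (simp add: pd_def)

lemma single_mult_pd_single:
  fixes d :: "'k::comm_ring_1"
  shows "Poly_Mapping.single (a - Poly_Mapping.single v 1 + b')
           (d * of_nat (Poly_Mapping.lookup a v)) =
         Poly_Mapping.single (a + b' - Poly_Mapping.single v (1::nat))
           (d * of_nat (Poly_Mapping.lookup a v))"
proof (cases "Poly_Mapping.lookup a v = 0")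
  case False
  then have "a - Poly_Mapping.single v 1 + b' = a + b' - Poly_Mapping.single v 1"
    by (intro poly_mapping_eqI) (auto simp: lookup_add lookup_minus lookup_single when_def)
  then show ?thesis by simp
qed simp

lemma pd_mult: "pd v (p * q) = pd v p * q + p * pd v q"
proof (induction p rule: mpoly_induct)
  case (single a c)
  show ?case
  proof (induction q rule: mpoly_induct)
    case (single b d)
    show ?case
      using single_mult_pd_single[of a v b "c * d"] single_mult_pd_single[of b v a "c * d"]
      by (simp add: pd_single mult_single lookup_add single_add[symmetric] algebra_simps)
  next
    case (add p q)
    then show ?case by (simp add: pd_add algebra_simps)
  qed
next
  case (add p q)
  then show ?case by (simp add: pd_add algebra_simps)
qed

lemma pd_Const: "pd v (Const c) = 0"
  by (simp add: Const_def pd_single)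

lemma pd_Var: "pd v (Var w) = (if v = w then 1 else 0)"
  by (simp add: Var_def pd_single lookup_single)

lemma pd_in_poly_algebra:
  assumes "p \<in> poly_algebra n" shows "pd v p \<in> poly_algebra n"
proof -
  have "Poly_Mapping.single (m - Poly_Mapping.single v 1) c \<in> poly_algebra n"
    if "m \<in> Poly_Mapping.keys p" for m and c :: 'a
  proof -
    have "Poly_Mapping.keys (m - Poly_Mapping.single v 1) \<subseteq> Poly_Mapping.keys m"
      by (auto simp: in_keys_iff lookup_minus)
    then show ?thesis using that assms by (auto simp: poly_algebra_def)
  qed
  then show ?thesis
    unfolding pd_def
    by (auto intro: sum_in_poly_algebra)
qed

lemma derivation_exists:
  "\<exists>D :: 'k::comm_ring_1 mpoly \<Rightarrow> 'k mpoly. derivation_on (poly_algebra n) D \<and>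
     (\<forall>i\<in>{1..n}. D (Var (X i)) = 0 \<and> D (Var (Y i)) = Var (X i) \<and> D (Var (Z i)) = Var (Y i))"
proof (intro exI conjI ballI)
  define D :: "'k mpoly \<Rightarrow> 'k mpoly" where
    "D p = (\<Sum>i=1..n. Var (X i) * pd (Y i) p + Var (Y i) * pd (Z i) p)" for p
  have D_in: "D p \<in> poly_algebra n" if "p \<in> poly_algebra n" for p
  proof -
    have "Var (X i) * pd (Y i) p + Var (Y i) * pd (Z i) p \<in> poly_algebra n" if "i \<in> {1..n}" for i
      using that \<open>p \<in> poly_algebra n\<close>
      by (intro add_in_poly_algebra mult_in_poly_algebra pd_in_poly_algebra Var_in_poly_algebra)
         (auto simp: pvars_upto_def)
    then show ?thesis
      unfolding D_def by (auto intro: sum_in_poly_algebra)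
  qed
  have D_add: "D (p + q) = D p + D q" for p q
    by (simp add: D_def pd_add algebra_simps sum.distrib)
  have D_mult: "D (p * q) = D p * q + p * D q" for p q
    by (simp add: D_def pd_mult algebra_simps sum.distrib sum_distrib_left)
  have D_Const: "D (Const c) = 0" for c
    by (simp add: D_def pd_Const)
  show "derivation_on (poly_algebra n) D"
    by (auto simp: derivation_on_def D_in D_add D_mult D_Const)
  fix i assume i: "i \<in> {1..n}"
  show "D (Var (X i)) = 0"
    by (simp add: D_def pd_Var)
  have "D (Var (Y i)) = (\<Sum>k=1..n. if k = i then Var (X k) else 0)"
    unfolding D_def by (intro sum.cong) (auto simp: pd_Var)
  then show "D (Var (Y i)) = Var (X i)" using i by simp
  have "D (Var (Z i)) = (\<Sum>k=1..n. if k = i then Var (Y k) else 0)"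
    unfolding D_def by (intro sum.cong) (auto simp: pd_Var)
  then show "D (Var (Z i)) = Var (Y i)" using i by simp
qed

end

theory Submission
  imports Defs
begin

text \<open>Induction on \<open>n\<close>. On polynomials in \<open>n + 1\<close> triples of variables the derivation is \<open>R + d\<close>, where
  \<open>R\<close> acts on the first \<open>n\<close> triples, \<open>d\<close> acts on the last triple \<open>x, y, z\<close>, and the two commute. For
  \<open>f\<close> in the kernel take \<open>j\<close> with \<open>d\<^sup>j\<^sup>+\<^sup>1 f = 0\<close>. Then \<open>g = d\<^sup>j f\<close> equals \<open>R\<^sup>j f\<close> up to sign, so it is
  killed by both \<open>d\<close> and \<open>R\<close>, and hence is a combination of terms \<open>x\<^sup>i Q\<^sup>k r\<close> with
  \<open>Q = 2xz - y\<^sup>2\<close> and \<open>r\<close> in the kernel of \<open>R\<close>, to which the induction hypothesis applies.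
  Both \<open>d\<close> and \<open>R\<close> are raising operators of sl2-triples, and a highest weight vector in the image of the
  \<open>j\<close>-th power has weight at least \<open>j/2\<close> (for weights normalised as degree in the \<open>x\<^sub>i\<close> minus degree in
  the \<open>z\<^sub>i\<close>). So \<open>i \<ge> j/2\<close>, and every product of generators occurring in \<open>r\<close> has at least \<open>j/2\<close> factors
  \<open>u\<close> of the forms \<open>x\<^sub>a\<close> and \<open>J\<^sub>a\<^sub>b\<close>. For each such \<open>u\<close> there are elements \<open>h, k\<close> of the generated
  algebra with \<open>d\<^sup>2 h = x u\<close> and \<open>d k = x u\<close>, and multiplying these together produces an element \<open>a\<close> of the
  algebra with \<open>d\<^sup>j a = g\<close>. Then \<open>d\<^sup>j (f - a) = 0\<close>, and one descends on \<open>j\<close>.\<close>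

section \<open>Derivations of the polynomial ring\<close>

text \<open>Each monomial is a product of powers of variables from \<open>V\<close>, and
  \<open>p\<close> is the finite sum of its terms. The set \<open>V\<close> allows the same
  induction for \<open>poly_algebra n\<close> and, with \<open>V = UNIV\<close>, for the whole
  ring.\<close>

lemma mpoly_generated [consumes 1, case_names const var add mult]:
  fixes p :: "'k::comm_ring_1 mpoly"
  assumes "\<forall>m\<in>Poly_Mapping.keys p. Poly_Mapping.keys m \<subseteq> V"
    and const: "\<And>c. P (Const c)"
    and var: "\<And>v. v \<in> V \<Longrightarrow> P (Var v)"
    and add: "\<And>p q. P p \<Longrightarrow> P q \<Longrightarrow> P (p + q)"
    and mult: "\<And>p q. P p \<Longrightarrow> P q \<Longrightarrow> P (p * q)"
  shows "P p"
proof -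
  have single_var: "P (Poly_Mapping.single (Poly_Mapping.single v k) 1)" if "v \<in> V" for v k
  proof (induction k)
    case 0
    then show ?case using const[of 1] by (simp add: Const_def)
  next
    case (Suc k)
    have "Poly_Mapping.single (Poly_Mapping.single v (Suc k)) (1::'k) =
      Var v * Poly_Mapping.single (Poly_Mapping.single v k) 1"
      by (simp add: Var_def mult_single single_add[symmetric])
    with Suc var[OF that] show ?case by (simp add: mult)
  qed
  have mono: "P (Poly_Mapping.single m 1)" if "Poly_Mapping.keys m \<subseteq> V" for m
    using that
  proof (induction m rule: update_induct)
    case const
    then show ?case using assms(2)[of 1] by (simp add: Const_def)
  next
    case (update f a b)
    have "Poly_Mapping.update a b f = f + Poly_Mapping.single a b"
      using update(1)
      by (intro poly_mapping_eqI)
         (auto simp: lookup_update lookup_add lookup_single when_def in_keys_iff)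
    moreover have "a \<in> V" "Poly_Mapping.keys f \<subseteq> V"
      using update by (auto simp: keys_update)
    ultimately show ?case
      using mult[OF update.IH single_var[of a b]] by (simp add: mult_single)
  qed
  have monom: "P (Poly_Mapping.single m c)" if "Poly_Mapping.keys m \<subseteq> V" for m c
    using mult[OF const[of c] mono[OF that]] by (simp add: Const_def mult_single)
  have "P (\<Sum>m\<in>S. Poly_Mapping.single m (Poly_Mapping.lookup p m))"
    if "finite S" "S \<subseteq> Poly_Mapping.keys p" for S
    using that
  proof (induction S rule: finite_induct)
    case empty
    then show ?case using const[of 0] by (simp add: Const_def)
  next
    case (insert m S)
    then show ?case using assms(1) by (auto intro: add monom)
  qed
  moreover have
    "(\<Sum>m\<in>Poly_Mapping.keys p. Poly_Mapping.single m (Poly_Mapping.lookup p m)) = p"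
    by (rule poly_mapping_eqI)
       (simp add: lookup_sum lookup_single when_def if_distrib sum.delta in_keys_iff cong: if_cong)
  ultimately show ?thesis
    by (metis finite_keys order_refl)
qed

lemmas mpoly_generated_UNIV = mpoly_generated[where V = UNIV, simplified, case_names const var add mult]

text \<open>Working on the ring in all variables at once removes membership side conditions;
  \<open>derivation_on_poly_algebra_unique\<close> makes the link to derivations given only on
  \<open>poly_algebra n\<close>.\<close>

abbreviation deriv :: "('k::comm_ring_1 mpoly \<Rightarrow> 'k mpoly) \<Rightarrow> bool" where
  "deriv \<equiv> derivation_on UNIV"

lemma Const_add: "Const (a + b) = Const a + Const (b :: 'k::comm_ring_1)"
  by (simp add: Const_def single_add)

lemma Const_mult: "Const (a * b) = Const a * Const (b :: 'k::comm_ring_1)"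
  by (simp add: Const_def mult_single)

lemma Const_0 [simp]: "Const 0 = 0"
  by (simp add: Const_def)

lemma Const_1 [simp]: "Const 1 = 1"
  by (simp add: Const_def)

lemma Const_diff: "Const (a - b) = Const a - Const (b :: 'k::comm_ring_1)"
  by (simp add: Const_def single_diff)

lemma Const_uminus: "Const (- a) = - Const (a :: 'k::comm_ring_1)"
  by (simp add: Const_def single_uminus)

lemma of_nat_eq_Const: "of_nat k = (Const (of_nat k) :: 'k::comm_ring_1 mpoly)"
  by (induction k) (simp_all add: Const_add)

lemma Const_mult_eq_0_iff: "Const c * p = 0 \<longleftrightarrow> c = 0 \<or> p = (0 :: 'k::field mpoly)"
proof
  assume *: "Const c * p = 0"
  show "c = 0 \<or> p = 0"
  proof (cases "c = 0")
    case False
    then have "p = Const (inverse c) * (Const c * p)"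
      by (simp add: mult.assoc[symmetric] Const_mult[symmetric])
    with * show ?thesis by simp
  qed simp
qed auto

lemma derivI:
  fixes d :: "'k::comm_ring_1 mpoly \<Rightarrow> 'k mpoly"
  assumes "\<And>p q. d (p + q) = d p + d q" "\<And>p q. d (p * q) = d p * q + p * d q"
    and "\<And>c. d (Const c) = 0"
  shows "deriv d"
  by (simp add: derivation_on_def assms(1,3) assms(2)[of "Const _"])
     (simp add: assms(2))

context
  fixes d :: "'k::comm_ring_1 mpoly \<Rightarrow> 'k mpoly"
  assumes d: "deriv d"
begin

lemma deriv_add: "d (p + q) = d p + d q"
  using d unfolding derivation_on_def by blast

lemma deriv_scale: "d (Const c * p) = Const c * d p"
  using d unfolding derivation_on_def by blast

lemma deriv_mult: "d (p * q) = d p * q + p * d q"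
  using d unfolding derivation_on_def by blast

lemma deriv_zero: "d 0 = 0"
  using deriv_add[of 0 0] by simp

lemma deriv_Const: "d (Const c) = 0"
proof -
  have "d 1 = d 1 + d 1"
    using deriv_mult[of 1 1] by simp
  then show ?thesis
    using deriv_scale[of c 1] by simp
qed

lemma deriv_one: "d 1 = 0"
  using deriv_Const[of 1] by simp

lemma deriv_uminus: "d (- p) = - d p"
  using deriv_add[of p "- p"] by (simp add: deriv_zero add_eq_0_iff)

lemma deriv_diff: "d (p - q) = d p - d q"
  using deriv_add[of p "- q"] by (simp add: deriv_uminus)

lemma deriv_sum: "d (\<Sum>i\<in>I. f i) = (\<Sum>i\<in>I. d (f i))"
  by (induction I rule: infinite_finite_induct) (simp_all add: deriv_zero deriv_add)

lemma deriv_power_zero: "d p = 0 \<Longrightarrow> d (p ^ k) = 0"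
  by (induction k) (simp_all add: deriv_one deriv_mult)

lemma deriv_iter_zero: "(d ^^ k) 0 = 0"
  by (induction k) (simp_all add: deriv_zero)

lemma deriv_iter_add: "(d ^^ k) (p + q) = (d ^^ k) p + (d ^^ k) q"
  by (induction k) (simp_all add: deriv_add)

lemma deriv_iter_diff: "(d ^^ k) (p - q) = (d ^^ k) p - (d ^^ k) q"
  by (induction k) (simp_all add: deriv_diff)

lemma deriv_iter_uminus: "(d ^^ k) (- p) = - (d ^^ k) p"
  by (induction k) (simp_all add: deriv_uminus)

lemma deriv_iter_scale: "(d ^^ k) (Const c * p) = Const c * (d ^^ k) p"
  by (induction k) (simp_all add: deriv_scale)

lemma deriv_iter_mult_const: "d p = 0 \<Longrightarrow> (d ^^ k) (p * q) = p * (d ^^ k) q"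
  by (induction k) (simp_all add: deriv_mult)

lemma deriv_iter_ge:
  assumes "(d ^^ k) p = 0" "k \<le> l"
  shows "(d ^^ l) p = 0"
proof -
  have "(d ^^ l) p = (d ^^ (l - k)) ((d ^^ k) p)"
    using assms(2) by (metis comp_apply funpow_add le_add_diff_inverse2)
  then show ?thesis by (simp add: assms deriv_iter_zero)
qed

text \<open>In the Leibniz expansion of order \<open>a + b\<close>, a term with more than
  \<open>a\<close> derivatives on \<open>p\<close> vanishes, and one with fewer has more than
  \<open>b\<close> on \<open>q\<close>. One binomial term survives. The induction on
  \<open>a + b\<close> bypasses the full expansion.\<close>

lemma deriv_iter_Leibniz_top:
  assumes "(d ^^ Suc a) p = 0" "(d ^^ Suc b) q = 0"
  shows "(d ^^ Suc (a + b)) (p * q) = 0"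
    and "(d ^^ (a + b)) (p * q) = of_nat ((a + b) choose a) * ((d ^^ a) p * (d ^^ b) q)"
proof -
  have "(d ^^ Suc (a + b)) (p * q) = 0 \<and>
    (d ^^ (a + b)) (p * q) = of_nat ((a + b) choose a) * ((d ^^ a) p * (d ^^ b) q)"
    using assms
  proof (induction "a + b" arbitrary: a b p q rule: less_induct)
    case less
    have A: "(d ^^ Suc (a + b)) (p * q) = (d ^^ (a + b)) (d p * q) + (d ^^ (a + b)) (p * d q)"
      by (simp add: funpow_Suc_right deriv_mult deriv_iter_add del: funpow.simps)
    \<comment> \<open>The induction hypothesis applies to \<open>d p\<close> with
      \<open>a - 1\<close> in place of \<open>a\<close>. For \<open>a = 0\<close> the factor
      \<open>d p\<close> is already zero, and the guard keeps truncated subtraction out of the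
      formula.\<close>
    have l: "(d ^^ (a + b)) (d p * q) = 0 \<and>
      (a \<noteq> 0 \<longrightarrow> (d ^^ (a + b - 1)) (d p * q) = of_nat ((a + b - 1) choose (a - 1)) * ((d ^^ a) p * (d ^^ b) q))"
    proof (cases a)
      case 0
      with less.prems show ?thesis by (simp add: deriv_iter_zero)
    next
      case (Suc a')
      have "(d ^^ Suc a') (d p) = 0"
        using less.prems Suc by (simp add: funpow_swap1)
      from less.hyps[OF _ this less.prems(2)] Suc show ?thesis
        by (simp add: funpow_Suc_right del: funpow.simps)
    qed
    have r: "(d ^^ (a + b)) (p * d q) = 0 \<and>
      (b \<noteq> 0 \<longrightarrow> (d ^^ (a + b - 1)) (p * d q) = of_nat ((a + b - 1) choose a) * ((d ^^ a) p * (d ^^ b) q))"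
    proof (cases b)
      case 0
      with less.prems show ?thesis by (simp add: deriv_iter_zero)
    next
      case (Suc b')
      have "(d ^^ Suc b') (d q) = 0"
        using less.prems Suc by (simp add: funpow_swap1)
      from less.hyps[OF _ less.prems(1) this] Suc show ?thesis
        by (simp add: funpow_Suc_right del: funpow.simps)
    qed
    have 1: "(d ^^ Suc (a + b)) (p * q) = 0"
      using A l r by simp
    have 2: "(d ^^ (a + b)) (p * q) = of_nat ((a + b) choose a) * ((d ^^ a) p * (d ^^ b) q)"
    proof (cases "a + b")
      case 0
      then show ?thesis by simp
    next
      case (Suc s)
      have B: "(d ^^ (a + b)) (p * q) = (d ^^ s) (d p * q) + (d ^^ s) (p * d q)"
        by (simp add: Suc funpow_Suc_right deriv_mult deriv_iter_add del: funpow.simps)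
      consider "a = 0" | "b = 0" "a \<noteq> 0" | a' b' where "a = Suc a'" "b = Suc b'"
        by (metis not0_implies_Suc)
      then show ?thesis
      proof cases
        case 1
        with less.prems l r Suc B show ?thesis by (simp add: deriv_iter_zero)
      next
        case 2
        with less.prems l r Suc B show ?thesis by (simp add: deriv_iter_zero)
      next
        case 3
        have s: "a + b - 1 = s" "a - 1 = a'" using Suc 3 by simp_all
        \<comment> \<open>Pascal's rule matches the two summands of the product rule.\<close>
        have c: "(a + b) choose a = (s choose a') + (s choose a)"
          using Suc 3 by simp
        have "(d ^^ s) (d p * q) = of_nat (s choose a') * ((d ^^ a) p * (d ^^ b) q)"
          using l 3 unfolding s by blast
        moreover have "(d ^^ s) (p * d q) = of_nat (s choose a) * ((d ^^ a) p * (d ^^ b) q)"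
          using r 3 unfolding s by blast
        ultimately show ?thesis
          unfolding B c by (simp only: of_nat_add distrib_right)
      qed
    qed
    from 1 2 show ?case by blast
  qed
  then show "(d ^^ Suc (a + b)) (p * q) = 0"
    and "(d ^^ (a + b)) (p * q) = of_nat ((a + b) choose a) * ((d ^^ a) p * (d ^^ b) q)"
    by auto
qed

text \<open>The elements killed by some power of \<open>d\<close> are closed under products by the
  Leibniz lemma, so only variables need testing.\<close>

lemma deriv_locally_nilpotent:
  assumes "\<And>v. \<exists>k. (d ^^ k) (Var v) = 0"
  shows "\<exists>k. (d ^^ k) p = 0"
proof -
  have "\<exists>k. (d ^^ Suc k) p = 0"
  proof (induction p rule: mpoly_generated_UNIV)
    case (const c)
    show ?case by (rule exI[of _ 0]) (simp add: deriv_Const)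
  next
    case (var v)
    show ?case using assms[of v] deriv_iter_ge le_Suc_eq by blast
  next
    case (add p q)
    then obtain a b where ab: "(d ^^ Suc a) p = 0" "(d ^^ Suc b) q = 0" by blast
    show ?case
      using deriv_iter_ge[OF ab(1), of "Suc (max a b)"] deriv_iter_ge[OF ab(2), of "Suc (max a b)"]
      by (intro exI[of _ "max a b"]) (simp only: deriv_iter_add, simp)
  next
    case (mult p q)
    then show ?case using deriv_iter_Leibniz_top(1) by blast
  qed
  then show ?thesis by blast
qed

end

lemma deriv_pd: "deriv (pd v)"
  by (intro derivI pd_add pd_mult pd_Const)

lemma deriv_mult_left: "deriv d \<Longrightarrow> deriv (\<lambda>p. q * d p)"
  by (rule derivI) (simp_all add: deriv_add deriv_mult deriv_Const algebra_simps)

lemma deriv_plus: "deriv d \<Longrightarrow> deriv e \<Longrightarrow> deriv (\<lambda>p. d p + e p)"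
  by (rule derivI) (simp_all add: deriv_add deriv_mult deriv_Const algebra_simps)

lemma deriv_minus: "deriv d \<Longrightarrow> deriv e \<Longrightarrow> deriv (\<lambda>p. d p - e p)"
  by (rule derivI) (simp_all add: deriv_add deriv_mult deriv_Const algebra_simps)

lemma deriv_sum_ops: "(\<And>i. i \<in> I \<Longrightarrow> deriv (d i)) \<Longrightarrow> deriv (\<lambda>p. \<Sum>i\<in>I. d i p)"
  by (rule derivI)
     (simp_all add: deriv_add deriv_mult deriv_Const sum.distrib sum_distrib_left sum_distrib_right)

lemma deriv_commutator: "deriv d \<Longrightarrow> deriv e \<Longrightarrow> deriv (\<lambda>p. d (e p) - e (d p))"
  by (rule derivI) (simp_all add: deriv_add deriv_mult deriv_Const deriv_zero algebra_simps)

lemma derivation_on_poly_algebra_unique: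
  fixes d e :: "'k::comm_ring_1 mpoly \<Rightarrow> 'k mpoly"
  assumes "derivation_on (poly_algebra n) d" "deriv e"
    and "\<And>v. v \<in> pvars_upto n \<Longrightarrow> d (Var v) = e (Var v)"
    and "p \<in> poly_algebra n"
  shows "d p = e p"
proof -
  note dd = assms(1)[unfolded derivation_on_def]
  have one: "(1 :: 'k mpoly) \<in> poly_algebra n"
    using Const_in_poly_algebra[of "1::'k" n] by simp
  have "d (1 * 1) = d 1 * 1 + 1 * d 1"
    using dd one by blast
  then have "d 1 = 0" by simp
  moreover have "d (Const c * 1) = Const c * d 1" for c
    using dd one by blast
  ultimately have dC: "d (Const c) = 0" for c by simp
  have "\<forall>m\<in>Poly_Mapping.keys p. Poly_Mapping.keys m \<subseteq> pvars_upto n"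
    using assms(4) by (simp add: poly_algebra_def)
  \<comment> \<open>Membership is carried through the induction because the laws of \<open>d\<close>
    hold only on \<open>poly_algebra n\<close>.\<close>
  then have "p \<in> poly_algebra n \<and> d p = e p"
  proof (induction p rule: mpoly_generated)
    case (const c)
    then show ?case by (simp add: Const_in_poly_algebra dC deriv_Const[OF assms(2)])
  next
    case (var v)
    then show ?case by (simp add: Var_in_poly_algebra assms(3))
  next
    case (add p q)
    then show ?case using dd by (simp add: add_in_poly_algebra deriv_add[OF assms(2)])
  next
    case (mult p q)
    then show ?case using dd by (simp add: mult_in_poly_algebra deriv_mult[OF assms(2)])
  qed
  then show ?thesis by blast
qed

lemma deriv_unique:
  assumes d: "deriv d" and e: "deriv e" and eq: "\<And>v. d (Var v) = e (Var v)"
  shows "d p = e p"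
proof (induction p rule: mpoly_generated_UNIV)
  case (const c)
  show ?case by (simp add: deriv_Const[OF d] deriv_Const[OF e])
next
  case (add p q)
  then show ?case by (simp add: deriv_add[OF d] deriv_add[OF e])
next
  case (mult p q)
  then show ?case by (simp add: deriv_mult[OF d] deriv_mult[OF e])
qed (auto simp: eq)

section \<open>The sl2-triple and weights\<close>

text \<open>The index set is a parameter because the induction splits the operator for
  \<open>{1..Suc n}\<close> into those for \<open>{1..n}\<close> and \<open>{Suc n}\<close>. With
  \<open>Eop\<close> and \<open>Hop\<close> it forms an sl2-triple up to rescaling.\<close>

definition Dop :: "nat set \<Rightarrow> 'k::comm_ring_1 mpoly \<Rightarrow> 'k mpoly" where
  "Dop I p = (\<Sum>i\<in>I. Var (X i) * pd (Y i) p + Var (Y i) * pd (Z i) p)"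

definition Eop :: "nat set \<Rightarrow> 'k::comm_ring_1 mpoly \<Rightarrow> 'k mpoly" where
  "Eop I p = (\<Sum>i\<in>I. Var (Y i) * pd (X i) p + Var (Z i) * pd (Y i) p)"

definition Hop :: "nat set \<Rightarrow> 'k::comm_ring_1 mpoly \<Rightarrow> 'k mpoly" where
  "Hop I p = (\<Sum>i\<in>I. Var (X i) * pd (X i) p - Var (Z i) * pd (Z i) p)"

definition weight :: "nat set \<Rightarrow> (pvar \<Rightarrow>\<^sub>0 nat) \<Rightarrow> int" where
  "weight I m = (\<Sum>i\<in>I. int (Poly_Mapping.lookup m (X i)) - int (Poly_Mapping.lookup m (Z i)))"

definition homog :: "nat set \<Rightarrow> int \<Rightarrow> 'k::zero mpoly \<Rightarrow> bool" where
  "homog I w p \<longleftrightarrow> (\<forall>m\<in>Poly_Mapping.keys p. weight I m = w)"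

text \<open>Projection onto the sum of the weight spaces with weight in \<open>S\<close>. Both
  singletons and half-lines of weights are used.\<close>

lift_definition filt :: "nat set \<Rightarrow> int set \<Rightarrow> 'k::zero mpoly \<Rightarrow> 'k mpoly"
  is "\<lambda>I S p m. if weight I m \<in> S then p m else 0"
  by (rule finite_subset) auto

lemma deriv_Dop: "deriv (Dop I)"
  unfolding Dop_def by (intro deriv_sum_ops deriv_plus deriv_mult_left deriv_pd)

lemma deriv_Eop: "deriv (Eop I)"
  unfolding Eop_def by (intro deriv_sum_ops deriv_plus deriv_mult_left deriv_pd)

lemma deriv_Hop: "deriv (Hop I)"
  unfolding Hop_def by (intro deriv_sum_ops deriv_minus deriv_mult_left deriv_pd)

lemmas Dop_zero [simp] = deriv_zero[OF deriv_Dop]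
lemmas Eop_zero [simp] = deriv_zero[OF deriv_Eop]
lemmas Hop_zero [simp] = deriv_zero[OF deriv_Hop]

lemma Dop_Var:
  assumes "finite I"
  shows "Dop I (Var (X i)) = 0"
    and "Dop I (Var (Y i)) = (if i \<in> I then Var (X i) else 0)"
    and "Dop I (Var (Z i)) = (if i \<in> I then Var (Y i) else 0)"
proof -
  show "Dop I (Var (X i)) = 0"
    by (simp add: Dop_def pd_Var)
  have "Dop I (Var (Y i)) = (\<Sum>k\<in>I. if k = i then Var (X i) else 0)"
    unfolding Dop_def by (rule sum.cong) (auto simp: pd_Var)
  with assms show "Dop I (Var (Y i)) = (if i \<in> I then Var (X i) else 0)"
    by simp
  have "Dop I (Var (Z i)) = (\<Sum>k\<in>I. if k = i then Var (Y i) else 0)"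
    unfolding Dop_def by (rule sum.cong) (auto simp: pd_Var)
  with assms show "Dop I (Var (Z i)) = (if i \<in> I then Var (Y i) else 0)"
    by simp
qed

lemma Eop_Var:
  assumes "finite I"
  shows "Eop I (Var (X i)) = (if i \<in> I then Var (Y i) else 0)"
    and "Eop I (Var (Y i)) = (if i \<in> I then Var (Z i) else 0)"
    and "Eop I (Var (Z i)) = 0"
proof -
  have "Eop I (Var (X i)) = (\<Sum>k\<in>I. if k = i then Var (Y i) else 0)"
    unfolding Eop_def by (rule sum.cong) (auto simp: pd_Var)
  with assms show "Eop I (Var (X i)) = (if i \<in> I then Var (Y i) else 0)"
    by simp
  have "Eop I (Var (Y i)) = (\<Sum>k\<in>I. if k = i then Var (Z i) else 0)"
    unfolding Eop_def by (rule sum.cong) (auto simp: pd_Var)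
  with assms show "Eop I (Var (Y i)) = (if i \<in> I then Var (Z i) else 0)"
    by simp
  show "Eop I (Var (Z i)) = 0"
    by (simp add: Eop_def pd_Var)
qed

lemma Hop_Var:
  assumes "finite I"
  shows "Hop I (Var (X i)) = (if i \<in> I then Var (X i) else 0)"
    and "Hop I (Var (Y i)) = 0"
    and "Hop I (Var (Z i)) = (if i \<in> I then - Var (Z i) else 0)"
proof -
  have "Hop I (Var (X i)) = (\<Sum>k\<in>I. if k = i then Var (X i) else 0)"
    unfolding Hop_def by (rule sum.cong) (auto simp: pd_Var)
  with assms show "Hop I (Var (X i)) = (if i \<in> I then Var (X i) else 0)"
    by simp
  show "Hop I (Var (Y i)) = 0"
    by (simp add: Hop_def pd_Var)
  have "Hop I (Var (Z i)) = (\<Sum>k\<in>I. if k = i then - Var (Z i) else 0)"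
    unfolding Hop_def by (rule sum.cong) (auto simp: pd_Var)
  with assms show "Hop I (Var (Z i)) = (if i \<in> I then - Var (Z i) else 0)"
    by simp
qed

text \<open>A commutator of derivations is a derivation, so this and the next two sl2 relations need
  checking only on variables.\<close>

lemma Dop_Eop_commutator:
  assumes "finite I"
  shows "Dop I (Eop I p) = Eop I (Dop I p) + Hop I p"
proof -
  have "Dop I (Eop I p) - Eop I (Dop I p) = Hop I p"
  proof (rule deriv_unique[OF deriv_commutator[OF deriv_Dop deriv_Eop] deriv_Hop])
    fix v
    show "Dop I (Eop I (Var v)) - Eop I (Dop I (Var v)) = Hop I (Var v)"
      using assms by (cases v) (simp_all add: Dop_Var Eop_Var Hop_Var)
  qed
  then show ?thesis by (simp add: algebra_simps)
qed

lemma Hop_Dop_commutator: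
  assumes "finite I"
  shows "Hop I (Dop I p) = Dop I (Hop I p) + Dop I p"
proof -
  have "Hop I (Dop I p) - Dop I (Hop I p) = Dop I p"
  proof (rule deriv_unique[OF deriv_commutator[OF deriv_Hop deriv_Dop] deriv_Dop])
    fix v
    show "Hop I (Dop I (Var v)) - Dop I (Hop I (Var v)) = Dop I (Var v)"
      using assms by (cases v) (simp_all add: Dop_Var Hop_Var deriv_uminus[OF deriv_Dop])
  qed
  then show ?thesis by (simp add: algebra_simps)
qed

lemma Hop_Eop_commutator:
  assumes "finite I"
  shows "Hop I (Eop I p) = Eop I (Hop I p) - Eop I p"
proof -
  \<comment> \<open>In this order the commutator is \<open>Eop I\<close> itself and not its
    negative, so \<open>deriv_Eop\<close> applies directly.\<close>
  have "Eop I (Hop I p) - Hop I (Eop I p) = Eop I p"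
  proof (rule deriv_unique[OF deriv_commutator[OF deriv_Eop deriv_Hop] deriv_Eop])
    fix v
    show "Eop I (Hop I (Var v)) - Hop I (Eop I (Var v)) = Eop I (Var v)"
      using assms by (cases v) (simp_all add: Eop_Var Hop_Var deriv_uminus[OF deriv_Eop])
  qed
  then show ?thesis by (simp add: algebra_simps)
qed

text \<open>Both composites send \<open>Z i\<close> to \<open>X i\<close> for \<open>i\<close> in
  both index sets and kill every other variable.\<close>

lemma Dop_commute:
  assumes "finite I" "finite K"
  shows "Dop I (Dop K p) = Dop K (Dop I p)"
proof -
  have "Dop I (Dop K p) - Dop K (Dop I p) = (\<lambda>_. 0) p"
  proof (rule deriv_unique[OF deriv_commutator[OF deriv_Dop deriv_Dop]])
    show "deriv (\<lambda>_. 0 :: 'a mpoly)" by (rule derivI) simp_all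
    fix v
    show "Dop I (Dop K (Var v)) - Dop K (Dop I (Var v)) = 0"
      using assms by (cases v) (simp_all add: Dop_Var)
  qed
  then show ?thesis by simp
qed

lemma Dop_Un: "finite I \<Longrightarrow> finite K \<Longrightarrow> I \<inter> K = {} \<Longrightarrow> Dop (I \<union> K) p = Dop I p + Dop K p"
  unfolding Dop_def by (rule sum.union_disjoint)

lemma Eop_nilpotent:
  assumes "finite I"
  shows "\<exists>k. (Eop I ^^ k) p = 0"
proof (rule deriv_locally_nilpotent[OF deriv_Eop])
  fix v
  show "\<exists>k. (Eop I ^^ k) (Var v) = 0"
    using assms
    by (intro exI[of _ 3], cases v) (simp_all add: numeral_3_eq_3 Eop_Var)
qed

lemma Dop_nilpotent:
  assumes "finite I"
  shows "\<exists>k. (Dop I ^^ k) p = 0"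
proof (rule deriv_locally_nilpotent[OF deriv_Dop])
  fix v
  show "\<exists>k. (Dop I ^^ k) (Var v) = 0"
    using assms
    by (intro exI[of _ 3], cases v) (simp_all add: numeral_3_eq_3 Dop_Var)
qed

section \<open>Coefficient formulas, and weights as eigenvalues of \<open>Hop\<close>\<close>

lemma lookup_Var_mult:
  fixes p :: "'k::comm_ring_1 mpoly"
  shows
  "Poly_Mapping.lookup (Var v * p) m =
    (if Poly_Mapping.lookup m v = 0 then 0
     else Poly_Mapping.lookup p (m - Poly_Mapping.single v 1))"
proof (induction p rule: mpoly_induct)
  case (single a c)
  have "Poly_Mapping.single v 1 + a = m \<longleftrightarrow>
    Poly_Mapping.lookup m v \<noteq> 0 \<and> a = m - Poly_Mapping.single v (1::nat)"
    by (auto simp: poly_mapping_eq_iff fun_eq_iff lookup_add lookup_minus lookup_single when_def)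
  then show ?case
    by (auto simp: Var_def mult_single lookup_single when_def)
next
  case (add p q)
  then show ?case by (simp add: distrib_left lookup_add)
qed

lemma lookup_pd:
  fixes p :: "'k::comm_ring_1 mpoly"
  shows
  "Poly_Mapping.lookup (pd v p) m =
    of_nat (Suc (Poly_Mapping.lookup m v)) * Poly_Mapping.lookup p (m + Poly_Mapping.single v 1)"
proof (induction p rule: mpoly_induct)
  case (single a c)
  have *: "a - Poly_Mapping.single v 1 = m \<longleftrightarrow> a = m + Poly_Mapping.single v (1::nat)"
    if "Poly_Mapping.lookup a v \<noteq> 0"
    using that
    by (auto simp: poly_mapping_eq_iff fun_eq_iff lookup_add lookup_minus lookup_single when_def)
  show ?case
  proof (cases "Poly_Mapping.lookup a v = 0")
    case True
    then have "a \<noteq> m + Poly_Mapping.single v 1"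
      by (auto simp: lookup_add)
    with True show ?thesis by (simp add: pd_single lookup_single when_def)
  next
    case False
    show ?thesis
    proof (cases "a = m + Poly_Mapping.single v 1")
      case True
      then have "a - Poly_Mapping.single v 1 = m" by simp
      with True show ?thesis by (simp add: pd_single lookup_add)
    next
      case neq: False
      then have "a - Poly_Mapping.single v 1 \<noteq> m" using * False by blast
      with neq show ?thesis by (simp add: pd_single lookup_single when_def)
    qed
  qed
next
  case (add p q)
  then show ?case by (simp add: pd_add lookup_add algebra_simps)
qed

lemma lookup_Const_mult:
  fixes p :: "'k::comm_ring_1 mpoly"
  shows "Poly_Mapping.lookup (Const c * p) m = c * Poly_Mapping.lookup p m"
proof (induction p rule: mpoly_induct)
  case (single a d)
  then show ?case by (simp add: Const_def mult_single lookup_single when_def)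
next
  case (add p q)
  then show ?case by (simp add: distrib_left lookup_add)
qed

lemma lookup_Var_mult_pd:
  "Poly_Mapping.lookup (Var v * pd v p) m = of_nat (Poly_Mapping.lookup m v) * Poly_Mapping.lookup p m"
proof (cases "Poly_Mapping.lookup m v")
  case (Suc k)
  then have "m - Poly_Mapping.single v 1 + Poly_Mapping.single v 1 = m"
    by (auto simp: poly_mapping_eq_iff fun_eq_iff lookup_add lookup_minus lookup_single when_def)
  with Suc show ?thesis
    by (simp add: lookup_Var_mult lookup_pd lookup_minus)
qed (simp add: lookup_Var_mult)

lemma lookup_Hop:
  "Poly_Mapping.lookup (Hop I p) m = of_int (weight I m) * Poly_Mapping.lookup p m"
  by (simp add: Hop_def weight_def lookup_sum lookup_minus lookup_Var_mult_pd
      sum_distrib_right left_diff_distrib)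

text \<open>\<open>Hop\<close> multiplies each monomial by its weight, and in characteristic 0
  distinct weights give distinct eigenvalues. The commutation relations thereby become statements
  about weight shifts.\<close>

lemma homog_iff_Hop:
  fixes p :: "'k::field_char_0 mpoly"
  shows "homog I w p \<longleftrightarrow> Hop I p = Const (of_int w) * p"
  unfolding homog_def poly_mapping_eq_iff fun_eq_iff lookup_Hop lookup_Const_mult
  by (auto simp: in_keys_iff)

context
  fixes I :: "nat set"
  assumes I: "finite I"
begin

lemma homog_Dop:
  fixes p :: "'k::field_char_0 mpoly"
  assumes "homog I w p"
  shows "homog I (w + 1) (Dop I p)"
  using assms I unfolding homog_iff_Hop
  by (simp add: Hop_Dop_commutator deriv_scale[OF deriv_Dop] Const_add distrib_right)

lemma homog_Eop:
  fixes p :: "'k::field_char_0 mpoly"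
  assumes "homog I w p"
  shows "homog I (w - 1) (Eop I p)"
  using assms I unfolding homog_iff_Hop
  by (simp add: Hop_Eop_commutator deriv_scale[OF deriv_Eop] Const_diff left_diff_distrib)

lemma homog_Dop_iter:
  fixes p :: "'k::field_char_0 mpoly"
  shows "homog I w p \<Longrightarrow> homog I (w + int k) ((Dop I ^^ k) p)"
  by (induction k) (auto dest: homog_Dop simp: algebra_simps)

lemma homog_Eop_iter:
  fixes p :: "'k::field_char_0 mpoly"
  shows "homog I w p \<Longrightarrow> homog I (w - int k) ((Eop I ^^ k) p)"
  by (induction k) (auto dest: homog_Eop simp: algebra_simps)

lemma homog_diff: "homog I w p \<Longrightarrow> homog I w q \<Longrightarrow> homog I w (p - q :: 'k::ab_group_add mpoly)"
  unfolding homog_def by (metis diff_0_right in_keys_iff lookup_minus)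

lemma homog_scale: "homog I w p \<Longrightarrow> homog I w (Const c * p :: 'k::comm_ring_1 mpoly)"
  unfolding homog_def by (auto simp: in_keys_iff lookup_Const_mult)

text \<open>Moving \<open>Eop\<close> past the copies of \<open>Dop\<close> one at a time leaves a
  copy of \<open>Hop\<close> acting on \<open>D^i u\<close>, whose weight is \<open>w + i\<close>;
  the sum collects these weights.\<close>

lemma Dop_iter_Eop:
  fixes u :: "'k::field_char_0 mpoly"
  assumes "homog I w u"
  shows "(Dop I ^^ Suc k) (Eop I u) =
    Eop I ((Dop I ^^ Suc k) u) + Const (of_int (\<Sum>i\<le>k. w + int i)) * (Dop I ^^ k) u"
proof (induction k)
  case 0
  then show ?case
    using assms I by (simp add: Dop_Eop_commutator homog_iff_Hop)
next
  case (Suc k)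
  have "Hop I ((Dop I ^^ Suc k) u) = Const (of_int (w + int (Suc k))) * (Dop I ^^ Suc k) u"
    using homog_Dop_iter[OF assms, of "Suc k"] unfolding homog_iff_Hop .
  then have "Dop I (Eop I ((Dop I ^^ Suc k) u)) =
    Eop I ((Dop I ^^ Suc (Suc k)) u) + Const (of_int (w + int (Suc k))) * (Dop I ^^ Suc k) u"
    using I by (simp add: Dop_Eop_commutator)
  moreover have "(Dop I ^^ Suc (Suc k)) (Eop I u) = Dop I (Eop I ((Dop I ^^ Suc k) u)) +
    Const (of_int (\<Sum>i\<le>k. w + int i)) * (Dop I ^^ Suc k) u"
    using Suc by (simp add: deriv_add[OF deriv_Dop] deriv_scale[OF deriv_Dop])
  ultimately show ?case
    by (simp only: sum.atMost_Suc of_int_add[of "sum _ _"] Const_add[of "of_int (sum _ _)"]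
        distrib_right) (simp only: ac_simps)
qed

text \<open>Here each commutation leaves \<open>Hop\<close> acting on \<open>E^i u\<close>, of
  weight \<open>w - i\<close>, and these weights add to the initial eigenvalue
  \<open>l\<close>.\<close>

lemma Dop_Eop_iter:
  fixes u :: "'k::field_char_0 mpoly"
  assumes "homog I w u" "Dop I (Eop I u) = Const (of_int l) * u"
  shows "Dop I ((Eop I ^^ Suc k) u) = Const (of_int (l + (\<Sum>i=1..k. w - int i))) * (Eop I ^^ k) u"
proof (induction k)
  case 0
  then show ?case using assms by simp
next
  case (Suc k)
  have "Hop I ((Eop I ^^ Suc k) u) = Const (of_int (w - int (Suc k))) * (Eop I ^^ Suc k) u"
    using homog_Eop_iter[OF assms(1), of "Suc k"] unfolding homog_iff_Hop .
  moreover have "Dop I ((Eop I ^^ Suc (Suc k)) u) =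
    Eop I (Dop I ((Eop I ^^ Suc k) u)) + Hop I ((Eop I ^^ Suc k) u)"
    using I by (simp add: Dop_Eop_commutator)
  moreover have "Eop I (Dop I ((Eop I ^^ Suc k) u)) =
    Const (of_int (l + (\<Sum>i=1..k. w - int i))) * (Eop I ^^ Suc k) u"
    unfolding Suc by (simp add: deriv_scale[OF deriv_Eop])
  moreover have "l + (\<Sum>i=1..Suc k. w - int i) = l + (\<Sum>i=1..k. w - int i) + (w - int (Suc k))"
    by simp
  ultimately show ?case
    by (simp only: of_int_add Const_add distrib_right)
qed

text \<open>By the induction hypothesis \<open>u\<close> is an eigenvector of \<open>DE\<close> with negative eigenvalue. Then so is
  every \<open>E\<^sup>l u\<close>, which is incompatible with \<open>E\<close> being locally nilpotent unless \<open>u = 0\<close>.\<close>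

lemma Dop_iter_injective:
  fixes u :: "'k::field_char_0 mpoly"
  assumes "homog I w u" "2 * w \<le> - int k" "(Dop I ^^ k) u = 0"
  shows "u = 0"
  using assms
proof (induction k arbitrary: u)
  case 0
  then show ?case by simp
next
  case (Suc k)
  define a where "a = (\<Sum>i\<le>k. w + int i)"
  \<comment> \<open>The arithmetic series in closed form, doubled to remain in the integers. Its
    second factor is negative since \<open>2 * w \<le> - (k + 1)\<close>.\<close>
  have a: "2 * a = (int k + 1) * (2 * w + int k)"
    unfolding a_def by (induction k) (simp_all add: algebra_simps)
  have "a < 0"
  proof -
    have "(int k + 1) * (2 * w + int k) < 0"
      using Suc.prems(2) by (intro mult_pos_neg) auto
    with a show ?thesis by linarith
  qed
  \<comment> \<open>As \<open>D^(k+1) u = 0\<close>, one term of the commutation formula drops out,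
    so \<open>D^k\<close> kills \<open>D E u - a u\<close>. This vector again has weight
    \<open>w\<close>, and the induction hypothesis makes it zero.\<close>
  have "(Dop I ^^ Suc k) (Eop I u) = Const (of_int a) * (Dop I ^^ k) u"
    using Dop_iter_Eop[OF Suc.prems(1), of k] Suc.prems(3)
    by (simp add: a_def)
  then have "(Dop I ^^ k) (Dop I (Eop I u) - Const (of_int a) * u) = 0"
    by (simp add: deriv_iter_diff[OF deriv_Dop] deriv_iter_scale[OF deriv_Dop] funpow_Suc_right
        del: funpow.simps)
  moreover have "homog I w (Dop I (Eop I u) - Const (of_int a) * u)"
    using homog_Dop[OF homog_Eop[OF Suc.prems(1)]] Suc.prems(1)
    by (intro homog_diff homog_scale) simp_all
  ultimately have "Dop I (Eop I u) - Const (of_int a) * u = 0"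
    using Suc.IH[of "Dop I (Eop I u) - Const (of_int a) * u"] Suc.prems(2) by linarith
  then have eig: "Dop I (Eop I u) = Const (of_int a) * u" by simp
  have E: "(Eop I ^^ l) u = 0" if "(Eop I ^^ Suc l) u = 0" for l
  proof -
    have "w \<le> 0"
      using Suc.prems(2) by linarith
    then have "(\<Sum>i=1..l. w - int i) \<le> 0"
      by (intro sum_nonpos) auto
    with \<open>a < 0\<close> have "a + (\<Sum>i=1..l. w - int i) \<noteq> 0" by linarith
    moreover have "Const (of_int (a + (\<Sum>i=1..l. w - int i))) * (Eop I ^^ l) u = 0"
      using Dop_Eop_iter[OF Suc.prems(1) eig, of l] that by simp
    ultimately show ?thesis
      unfolding Const_mult_eq_0_iff of_int_eq_0_iff by blast
  qed
  obtain l where "(Eop I ^^ l) u = 0"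
    using Eop_nilpotent[OF I] by blast
  then show "u = 0"
    by (induction l) (simp, blast intro: E)
qed

section \<open>Weight components and the weights occurring in an image of \<open>Dop\<close>\<close>

lemma lookup_filt: "Poly_Mapping.lookup (filt I S p) m = (if weight I m \<in> S then Poly_Mapping.lookup p m else 0)"
  by transfer simp

lemma filt_add: "filt I S (p + q) = filt I S p + filt I S (q :: 'k::comm_ring_1 mpoly)"
  by (rule poly_mapping_eqI) (simp add: lookup_filt lookup_add)

lemma filt_homog: "homog I w p \<Longrightarrow> filt I S p = (if w \<in> S then p else 0)"
  by (rule poly_mapping_eqI) (auto simp: lookup_filt homog_def in_keys_iff)

lemma homog_filt: "homog I w (filt I {w} p)"
  by (auto simp: homog_def in_keys_iff lookup_filt split: if_splits)

lemma filt_Dop: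
  fixes p :: "'k::field_char_0 mpoly"
  shows "filt I {w + 1} (Dop I p) = Dop I (filt I {w} p)"
proof (induction p rule: mpoly_induct)
  case (single m c)
  have "homog I (weight I m) (Poly_Mapping.single m c)"
    by (simp add: homog_def)
  from filt_homog[OF this] filt_homog[OF homog_Dop[OF this]] show ?case
    by auto
next
  case (add p q)
  then show ?case by (simp add: filt_add deriv_add[OF deriv_Dop])
qed

lemma filt_Dop_iter:
  fixes p :: "'k::field_char_0 mpoly"
  shows "filt I {w + int j} ((Dop I ^^ j) p) = (Dop I ^^ j) (filt I {w} p)"
proof (induction j)
  case (Suc j)
  then show ?case
    using filt_Dop[of "w + int j" "(Dop I ^^ j) p"] by (simp add: algebra_simps)
qed simp

text \<open>The part of \<open>D^j f\<close> of the weight of \<open>m\<close> comes from the part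
  \<open>u\<close> of \<open>f\<close> whose weight \<open>w\<close> is lower by \<open>j\<close>.
  The bound gives \<open>2 * w < - j\<close>, hence \<open>2 * w \<le> - (j + 1)\<close> for
  integers, and \<open>D^(j+1)\<close> is injective in that weight, so \<open>u = 0\<close>.\<close>

lemma Dop_image_kernel_weight:
  fixes f :: "'k::field_char_0 mpoly"
  assumes "(Dop I ^^ Suc j) f = 0" "2 * weight I m < int j"
  shows "Poly_Mapping.lookup ((Dop I ^^ j) f) m = 0"
proof -
  define w where "w = weight I m - int j"
  define u where "u = filt I {w} f"
  have "(Dop I ^^ Suc j) u = filt I {w + int (Suc j)} ((Dop I ^^ Suc j) f)"
    unfolding u_def by (rule filt_Dop_iter[symmetric])
  also have "\<dots> = 0"
    unfolding assms(1) by (rule poly_mapping_eqI) (simp add: lookup_filt)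
  finally have "u = 0"
    using assms(2) by (intro Dop_iter_injective[of w u "Suc j"]) (auto simp: u_def homog_filt w_def)
  then have "filt I {weight I m} ((Dop I ^^ j) f) = 0"
    using filt_Dop_iter[of w j f] by (simp add: u_def w_def deriv_iter_zero[OF deriv_Dop])
  from arg_cong[OF this, of "\<lambda>p. Poly_Mapping.lookup p m"] show ?thesis
    by (simp add: lookup_filt)
qed

end

section \<open>Coefficients with respect to one variable\<close>

text \<open>The coefficient of \<open>Var v ^ k\<close> in \<open>p\<close> read as a polynomial in
  \<open>v\<close> over the other variables. The test on the exponent of \<open>v\<close> makes the
  result free of \<open>v\<close>.\<close>

lift_definition cf :: "pvar \<Rightarrow> nat \<Rightarrow> 'k::zero mpoly \<Rightarrow> 'k mpoly"
  is "\<lambda>v k p m. if Poly_Mapping.lookup m v = 0 then p (m + Poly_Mapping.single v k) else 0"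
proof -
  fix v k and p :: "(pvar \<Rightarrow>\<^sub>0 nat) \<Rightarrow> 'k"
  assume "finite {m. p m \<noteq> 0}"
  then have "finite ((\<lambda>m. m + Poly_Mapping.single v k) -` {m. p m \<noteq> 0})"
    by (rule finite_vimageI) (simp add: inj_on_def)
  then show "finite {m. (if Poly_Mapping.lookup m v = 0 then p (m + Poly_Mapping.single v k) else 0) \<noteq> 0}"
    by (rule rev_finite_subset) auto
qed

lemma lookup_cf:
  "Poly_Mapping.lookup (cf v k p) m =
    (if Poly_Mapping.lookup m v = 0 then Poly_Mapping.lookup p (m + Poly_Mapping.single v k) else 0)"
  by transfer simp

lemma cf_zero [simp]: "cf v k 0 = 0"
  by (rule poly_mapping_eqI) (simp add: lookup_cf)

lemma cf_add: "cf v k (p + q) = cf v k p + cf v k (q :: 'k::comm_ring_1 mpoly)"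
  by (rule poly_mapping_eqI) (simp add: lookup_cf lookup_add)

lemma cf_diff: "cf v k (p - q) = cf v k p - cf v k (q :: 'k::comm_ring_1 mpoly)"
  by (rule poly_mapping_eqI) (simp add: lookup_cf lookup_minus)

lemma cf_sum: "cf v k (\<Sum>i\<in>I. f i) = (\<Sum>i\<in>I. cf v k (f i :: 'k::comm_ring_1 mpoly))"
  by (induction I rule: infinite_finite_induct) (simp_all add: cf_add)

lemma cf_scale: "cf v k (Const c * p) = Const c * cf v k (p :: 'k::comm_ring_1 mpoly)"
  by (rule poly_mapping_eqI) (simp add: lookup_cf lookup_Const_mult)

lemma cf_of_nat: "cf v k (of_nat c * p) = of_nat c * cf v k (p :: 'k::comm_ring_1 mpoly)"
  by (simp add: of_nat_eq_Const cf_scale)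

lemma cf_Var_same_0: "cf v 0 (Var v * p) = (0 :: 'k::comm_ring_1 mpoly)"
  by (rule poly_mapping_eqI) (simp add: lookup_cf lookup_Var_mult)

lemma cf_Var_same_Suc: "cf v (Suc k) (Var v * p) = cf v k (p :: 'k::comm_ring_1 mpoly)"
proof (rule poly_mapping_eqI)
  fix m
  have "m + Poly_Mapping.single v (Suc k) - Poly_Mapping.single v 1 = m + Poly_Mapping.single v k"
    by (rule poly_mapping_eqI) (simp add: lookup_add lookup_minus lookup_single when_def)
  then show "Poly_Mapping.lookup (cf v (Suc k) (Var v * p)) m = Poly_Mapping.lookup (cf v k p) m"
    by (simp add: lookup_cf lookup_Var_mult lookup_add)
qed

lemma cf_Var_other:
  assumes "v \<noteq> w"
  shows "cf v k (Var w * p) = Var w * cf v k (p :: 'k::comm_ring_1 mpoly)"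
proof (rule poly_mapping_eqI)
  fix m
  have "m + Poly_Mapping.single v k - Poly_Mapping.single w 1 =
      m - Poly_Mapping.single w 1 + Poly_Mapping.single v k"
    by (rule poly_mapping_eqI) (use assms in \<open>auto simp: lookup_add lookup_minus lookup_single when_def\<close>)
  then show "Poly_Mapping.lookup (cf v k (Var w * p)) m = Poly_Mapping.lookup (Var w * cf v k p) m"
    using assms by (simp add: lookup_cf lookup_Var_mult lookup_add lookup_minus lookup_single_not_eq)
qed

lemma cf_pd_same: "cf v k (pd v p) = of_nat (Suc k) * cf v (Suc k) (p :: 'k::comm_ring_1 mpoly)"
proof (rule poly_mapping_eqI)
  fix m
  have "m + Poly_Mapping.single v k + Poly_Mapping.single v 1 = m + Poly_Mapping.single v (Suc k)"
    by (rule poly_mapping_eqI) (simp add: lookup_add lookup_single when_def)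
  then show "Poly_Mapping.lookup (cf v k (pd v p)) m =
      Poly_Mapping.lookup (of_nat (Suc k) * cf v (Suc k) p) m"
    unfolding of_nat_eq_Const by (simp add: lookup_cf lookup_pd lookup_add lookup_Const_mult)
qed

lemma cf_pd_other:
  assumes "v \<noteq> w"
  shows "cf v k (pd w p) = pd w (cf v k (p :: 'k::comm_ring_1 mpoly))"
  by (rule poly_mapping_eqI)
     (use assms in \<open>simp add: lookup_cf lookup_pd lookup_add lookup_single_not_eq add_ac\<close>)

lemma pd_cf_same: "pd v (cf v k p) = (0 :: 'k::comm_ring_1 mpoly)"
  by (rule poly_mapping_eqI) (simp add: lookup_cf lookup_pd lookup_add)

lemma cf_cf_same: "cf v j (cf v k p) = (if j = 0 then cf v k p else (0 :: 'k::comm_ring_1 mpoly))"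
  by (rule poly_mapping_eqI) (simp add: lookup_cf lookup_add)

lemma cf_commute: "v \<noteq> w \<Longrightarrow> cf v j (cf w k p) = cf w k (cf v j (p :: 'k::comm_ring_1 mpoly))"
  by (rule poly_mapping_eqI) (simp add: lookup_cf lookup_add lookup_single_not_eq add_ac)

lemma cf_power_same:
  "cf v k (Var v ^ j * p) = (if j \<le> k then cf v (k - j) p else (0 :: 'k::comm_ring_1 mpoly))"
proof (induction j arbitrary: k)
  case (Suc j)
  then show ?case
    by (cases k) (simp_all add: mult.assoc cf_Var_same_0 cf_Var_same_Suc)
qed simp

lemma cf_power_other:
  "v \<noteq> w \<Longrightarrow> cf v k (Var w ^ j * p) = Var w ^ j * cf v k (p :: 'k::comm_ring_1 mpoly)"
  by (induction j) (simp_all add: mult.assoc cf_Var_other)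

lemma cf_bound: "\<exists>M. \<forall>k>M. cf v k p = (0 :: 'k::comm_ring_1 mpoly)"
proof (intro exI allI impI)
  fix k assume k: "k > Max (insert 0 ((\<lambda>m. Poly_Mapping.lookup m v) ` Poly_Mapping.keys p))"
  have "Poly_Mapping.lookup p (m + Poly_Mapping.single v k) = 0" for m
  proof (rule ccontr)
    assume "Poly_Mapping.lookup p (m + Poly_Mapping.single v k) \<noteq> 0"
    then have "Poly_Mapping.lookup (m + Poly_Mapping.single v k) v
        \<in> (\<lambda>m. Poly_Mapping.lookup m v) ` Poly_Mapping.keys p"
      by (auto simp: in_keys_iff)
    then have "Poly_Mapping.lookup (m + Poly_Mapping.single v k) v
        \<le> Max (insert 0 ((\<lambda>m. Poly_Mapping.lookup m v) ` Poly_Mapping.keys p))"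
      by (intro Max_ge) auto
    moreover have "Poly_Mapping.lookup (m + Poly_Mapping.single v k) v \<ge> k"
      by (simp add: lookup_add)
    ultimately show False using k by linarith
  qed
  then show "cf v k p = 0"
    by (intro poly_mapping_eqI) (simp add: lookup_cf)
qed

text \<open>For \<open>a\<close> outside \<open>I\<close> the operator \<open>Dop I\<close> is
  linear over the polynomials in the variables of index \<open>a\<close>, so it acts
  coefficientwise.\<close>

lemma cf_Dop:
  assumes "a \<notin> I" "v \<in> {X a, Y a, Z a}"
  shows "cf v k (Dop I p) = Dop I (cf v k (p :: 'k::comm_ring_1 mpoly))"
  unfolding Dop_def cf_sum
proof (rule sum.cong)
  fix i assume "i \<in> I"
  with assms have "v \<noteq> X i" "v \<noteq> Y i" "v \<noteq> Z i" by auto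
  then show "cf v k (Var (X i) * pd (Y i) p + Var (Y i) * pd (Z i) p) =
      Var (X i) * pd (Y i) (cf v k p) + Var (Y i) * pd (Z i) (cf v k p)"
    by (simp add: cf_add cf_Var_other cf_pd_other)
qed simp

section \<open>The kernel of the derivation on three variables\<close>

definition coeff3 :: "nat \<Rightarrow> nat \<Rightarrow> nat \<Rightarrow> nat \<Rightarrow> 'k::zero mpoly \<Rightarrow> 'k mpoly" where
  "coeff3 a i j k p = cf (X a) i (cf (Y a) j (cf (Z a) k p))"

lemma coeff3_Dop:
  fixes p :: "'k::comm_ring_1 mpoly"
  shows "coeff3 a i j k (Dop {a} p) =
    (case i of 0 \<Rightarrow> 0 | Suc i' \<Rightarrow> of_nat (Suc j) * coeff3 a i' (Suc j) k p) +
    (case j of 0 \<Rightarrow> 0 | Suc j' \<Rightarrow> of_nat (Suc k) * coeff3 a i j' (Suc k) p)"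
  by (cases i; cases j)
     (simp_all add: coeff3_def Dop_def cf_add cf_Var_other cf_pd_other cf_pd_same cf_of_nat
       cf_Var_same_0 cf_Var_same_Suc del: of_nat_Suc)

lemma coeff3_eq_0_imp:
  fixes p :: "'k::comm_ring_1 mpoly"
  assumes "\<And>i j k. coeff3 a i j k p = 0"
  shows "p = 0"
proof (rule poly_mapping_eqI)
  fix m :: "pvar \<Rightarrow>\<^sub>0 nat"
  let ?x = "Poly_Mapping.lookup m (X a)"
  let ?y = "Poly_Mapping.lookup m (Y a)"
  let ?z = "Poly_Mapping.lookup m (Z a)"
  let ?e = "Poly_Mapping.single (X a) ?x + Poly_Mapping.single (Y a) ?y + Poly_Mapping.single (Z a) ?z"
  have 1: "m - ?e + Poly_Mapping.single (X a) ?x + Poly_Mapping.single (Y a) ?y +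
      Poly_Mapping.single (Z a) ?z = m"
    by (rule poly_mapping_eqI) (auto simp: lookup_add lookup_minus lookup_single when_def)
  have "Poly_Mapping.lookup (coeff3 a ?x ?y ?z p) (m - ?e) = Poly_Mapping.lookup p m"
    unfolding coeff3_def lookup_cf 1
    by (simp add: lookup_add lookup_minus lookup_single when_def)
  with assms show "Poly_Mapping.lookup p m = Poly_Mapping.lookup 0 m" by simp
qed

text \<open>Comparison of coefficients in \<open>Dop {a} p = 0\<close>. The first two recurrences
  lower the exponent of \<open>z\<close>; the third starts the vanishing of odd powers of
  \<open>y\<close>.\<close>

lemma Dop_kernel_coeff3:
  fixes p :: "'k::field_char_0 mpoly"
  assumes "Dop {a} p = 0"
  shows "of_nat (Suc k) * coeff3 a 0 j (Suc k) p = 0"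
    and "of_nat (Suc k) * coeff3 a (Suc i) j (Suc k) p = - (of_nat (Suc (Suc j)) * coeff3 a i (Suc (Suc j)) k p)"
    and "coeff3 a i (Suc 0) k p = 0"
proof -
  have D: "coeff3 a i j k (Dop {a} p) = 0" for i j k
    by (simp add: assms coeff3_def)
  show "of_nat (Suc k) * coeff3 a 0 j (Suc k) p = 0"
    using D[of 0 "Suc j" k] unfolding coeff3_Dop by simp
  show "of_nat (Suc k) * coeff3 a (Suc i) j (Suc k) p = - (of_nat (Suc (Suc j)) * coeff3 a i (Suc (Suc j)) k p)"
    using D[of "Suc i" "Suc j" k] unfolding coeff3_Dop by (simp add: add_eq_0_iff2 del: of_nat_Suc)
  show "coeff3 a i (Suc 0) k p = 0"
    using D[of "Suc i" 0 k] unfolding coeff3_Dop by simp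
qed

lemma of_nat_Suc_mult_eq_0: "of_nat (Suc k) * p = (0 :: 'k::field_char_0 mpoly) \<Longrightarrow> p = 0"
  unfolding of_nat_eq_Const Const_mult_eq_0_iff by (simp del: of_nat_Suc)

text \<open>The second recurrence passes vanishing from exponent \<open>j\<close> of
  \<open>y\<close> to \<open>j + 2\<close>, after division by an integer that is nonzero in
  characteristic 0.\<close>

lemma Dop_kernel_odd:
  fixes p :: "'k::field_char_0 mpoly"
  assumes "Dop {a} p = 0"
  shows "coeff3 a i (Suc (2 * l)) k p = 0"
proof (induction l arbitrary: i k)
  case 0
  then show ?case using Dop_kernel_coeff3(3)[OF assms] by simp
next
  case (Suc l)
  have "of_nat (Suc (Suc (Suc (2 * l)))) * coeff3 a i (Suc (Suc (Suc (2 * l)))) k p = 0"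
    using Dop_kernel_coeff3(2)[OF assms, of k i "Suc (2 * l)"] by (simp add: Suc del: of_nat_Suc)
  then show ?case
    by (auto dest: of_nat_Suc_mult_eq_0 simp del: of_nat_Suc)
qed

text \<open>The recurrences express the part of degree \<open>k + 1\<close> in \<open>z\<close>
  through that of degree \<open>k\<close>, so a kernel element is determined by its
  \<open>z\<close>-free part.\<close>

lemma Dop_kernel_determined:
  fixes p :: "'k::field_char_0 mpoly"
  assumes "Dop {a} p = 0" "\<And>i j. coeff3 a i j 0 p = 0"
  shows "p = 0"
proof (rule coeff3_eq_0_imp)
  fix i j k
  show "coeff3 a i j k p = 0"
  proof (induction k arbitrary: i j)
    case 0
    show ?case by (rule assms(2))
  next
    case (Suc k)
    have "of_nat (Suc k) * coeff3 a i j (Suc k) p = 0"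
      using Dop_kernel_coeff3(1,2)[OF assms(1), of k] Suc by (cases i) (simp_all del: of_nat_Suc)
    then show ?case by (rule of_nat_Suc_mult_eq_0)
  qed
qed

lemma Dop_single: "Dop {a} p = Var (X a) * pd (Y a) p + Var (Y a) * pd (Z a) p"
  by (simp add: Dop_def)

lemma Dop_H_diag: "Dop {a} (H a a :: 'k::comm_ring_1 mpoly) = 0"
  unfolding H_def
  by (simp only: deriv_add[OF deriv_Dop] deriv_diff[OF deriv_Dop] deriv_mult[OF deriv_Dop])
     (simp add: Dop_Var)

text \<open>Taking \<open>cf (Z a) 0\<close> amounts to setting \<open>z = 0\<close>, which turns
  \<open>H a a = 2xz - y^2\<close> into \<open>- y^2\<close>.\<close>

lemma cf_H_power:
  "cf (Z a) 0 (H a a ^ k * p) = Const ((- 1) ^ k) * (Var (Y a) ^ (2 * k) * cf (Z a) 0 (p :: 'k::comm_ring_1 mpoly))"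
proof (induction k)
  case (Suc k)
  have "H a a ^ Suc k * p = Var (Z a) * (Var (X a) * (H a a ^ k * p)) -
      Var (Y a) * (Var (Y a) * (H a a ^ k * p)) + Var (Z a) * (Var (X a) * (H a a ^ k * p))"
    by (simp add: H_def algebra_simps)
  then have "cf (Z a) 0 (H a a ^ Suc k * p) = - (Var (Y a) * (Var (Y a) * cf (Z a) 0 (H a a ^ k * p)))"
    by (simp only: cf_add cf_diff cf_Var_same_0) (simp add: cf_Var_other)
  also have "\<dots> = Const ((- 1) ^ Suc k) * (Var (Y a) ^ (2 * Suc k) * cf (Z a) 0 p)"
    unfolding Suc by (simp add: Const_uminus algebra_simps)
  finally show ?case .
qed simp

text \<open>The \<open>z\<close>-free part of \<open>g\<close> contains only even powers of
  \<open>y\<close>, and \<open>(-1)^k x^i Q^k\<close> with \<open>Q = H a a\<close> has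
  \<open>z\<close>-free part \<open>x^i y^(2k)\<close>. The sum therefore has the same
  \<open>z\<close>-free part as \<open>g\<close>, and both lie in the kernel.\<close>

lemma Dop_kernel_expansion:
  fixes g :: "'k::field_char_0 mpoly"
  assumes g: "Dop {a} g = 0"
  obtains M where "g = (\<Sum>i\<le>M. \<Sum>k\<le>M.
    Const ((- 1) ^ k) * (Var (X a) ^ i * (H a a ^ k * coeff3 a i (2 * k) 0 g)))"
proof -
  obtain M1 where M1: "cf (X a) i g = 0" if "i > M1" for i
    using cf_bound by blast
  obtain M2 where M2: "cf (Y a) i g = 0" if "i > M2" for i
    using cf_bound by blast
  define M where "M = max M1 M2"
  define r where "r i k = coeff3 a i k 0 g" for i k
  define s where "s = (\<Sum>i\<le>M. \<Sum>k\<le>M. Const ((- 1) ^ k) * (Var (X a) ^ i * (H a a ^ k * r i (2 * k))))"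
  \<comment> \<open>The extractions commute, so either the \<open>x\<close>-coefficient or the
    \<open>y\<close>-coefficient can be taken first, where the degree bounds apply.\<close>
  have r_out: "r i j = 0" if "i > M \<or> j > M" for i j
  proof -
    have "r i j = cf (Y a) j (cf (Z a) 0 (cf (X a) i g))"
      by (simp add: r_def coeff3_def cf_commute[of "X a"])
    moreover have "r i j = cf (X a) i (cf (Z a) 0 (cf (Y a) j g))"
      by (simp add: r_def coeff3_def cf_commute[of "Y a"])
    ultimately show ?thesis
      using that M1[of i] M2[of j] by (auto simp: M_def)
  qed
  have rX: "cf (X a) i' (r i j) = (if i' = 0 then r i j else 0)" for i i' j
    by (simp add: r_def coeff3_def cf_cf_same)
  have rY: "cf (Y a) i' (r i j) = (if i' = 0 then r i j else 0)" for i i' j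
    by (simp add: r_def coeff3_def cf_cf_same cf_commute[of "Y a" "X a"])
  have rZ: "cf (Z a) 0 (r i j) = r i j" for i j
    by (simp add: r_def coeff3_def cf_cf_same cf_commute[of "Z a" "X a"] cf_commute[of "Z a" "Y a"])
  have Dr: "Dop {a} (r i j) = 0" for i j
    by (simp add: r_def coeff3_def Dop_single cf_pd_other[symmetric] pd_cf_same)
  have "Dop {a} s = 0"
    unfolding s_def
    by (simp add: deriv_sum[OF deriv_Dop] deriv_Const[OF deriv_Dop] deriv_mult[OF deriv_Dop] Dr
        deriv_power_zero[OF deriv_Dop Dop_H_diag] deriv_power_zero[OF deriv_Dop] Dop_Var)
  have sq: "Const ((- 1) ^ k) * (Const ((- 1) ^ k) * q) = q" for k and q :: "'k mpoly"
    by (simp add: mult.assoc[symmetric] Const_mult[symmetric] power_mult_distrib[symmetric])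
  have cs: "coeff3 a i' j' 0 s = (\<Sum>i\<le>M. \<Sum>k\<le>M. if i' = i \<and> j' = 2 * k then r i j' else 0)" for i' j'
  proof -
    have "coeff3 a i' j' 0 (Const ((- 1) ^ k) * (Var (X a) ^ i * (H a a ^ k * r i (2 * k)))) =
      (if i' = i \<and> j' = 2 * k then r i j' else 0)" for i k
      by (auto simp: coeff3_def cf_scale cf_power_other cf_power_same cf_H_power rX rY rZ
          sq)
    then show ?thesis
      unfolding s_def coeff3_def cf_sum by simp
  qed
  have "coeff3 a i j 0 (g - s) = 0" for i j
  proof (cases "even j")
    case False
    then obtain l where l: "j = Suc (2 * l)" by (metis oddE Suc_eq_plus1)
    then have "j \<noteq> 2 * k" for k by presburger
    then have "coeff3 a i j 0 s = 0" unfolding cs by simp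
    moreover have "coeff3 a i j 0 g = 0" unfolding l by (rule Dop_kernel_odd[OF g])
    ultimately show ?thesis by (simp add: coeff3_def cf_diff)
  next
    case True
    then obtain l where l: "j = 2 * l" by blast
    have "coeff3 a i j 0 s = (\<Sum>i'\<le>M. if i = i' then (\<Sum>k\<le>M. if l = k then r i j else 0) else 0)"
      unfolding cs l by (intro sum.cong) auto
    also have "\<dots> = (if i \<le> M \<and> l \<le> M then r i j else 0)"
      by simp
    also have "\<dots> = r i j"
      using r_out[of i j] l by auto
    finally show ?thesis by (simp add: coeff3_def cf_diff r_def)
  qed
  moreover have "Dop {a} (g - s) = 0"
    using g \<open>Dop {a} s = 0\<close> by (simp add: deriv_diff[OF deriv_Dop])
  ultimately have "g - s = 0"
    by (rule Dop_kernel_determined[rotated])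
  then show ?thesis
    using that[of M] by (simp add: s_def r_def)
qed

section \<open>The algebra generated by the proposed generators\<close>

definition gens :: "nat \<Rightarrow> 'k::comm_ring_1 mpoly set" where
  "gens n = {Var (X i) | i. 1 \<le> i \<and> i \<le> n} \<union>
       {J i j | i j. 1 \<le> i \<and> i < j \<and> j \<le> n} \<union>
       {H i j | i j. 1 \<le> i \<and> i \<le> j \<and> j \<le> n} \<union>
       {Delta i j k | i j k. 1 \<le> i \<and> i < j \<and> j < k \<and> k \<le> n}"

text \<open>These are highest weight vectors of weight 1, each generating a copy of the
  3-dimensional representation; \<open>inv_gens\<close> consists of sl2-invariants. The split is by
  weight.\<close>

definition vec_gens :: "nat \<Rightarrow> 'k::comm_ring_1 mpoly set" where
  "vec_gens n = {Var (X i) | i. 1 \<le> i \<and> i \<le> n} \<union> {J i j | i j. 1 \<le> i \<and> i < j \<and> j \<le> n}"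

definition inv_gens :: "nat \<Rightarrow> 'k::comm_ring_1 mpoly set" where
  "inv_gens n = {H i j | i j. 1 \<le> i \<and> i \<le> j \<and> j \<le> n} \<union>
       {Delta i j k | i j k. 1 \<le> i \<and> i < j \<and> j < k \<and> k \<le> n}"

lemma gens_eq: "gens n = vec_gens n \<union> inv_gens n"
  by (simp add: gens_def vec_gens_def inv_gens_def Un_assoc)

definition gen_alg :: "nat \<Rightarrow> 'k::comm_ring_1 mpoly set" where
  "gen_alg n = subalgebra hull gens n"

lemma subalgebra_gen_alg: "subalgebra (gen_alg n)"
  unfolding gen_alg_def by (rule hull_in) (auto simp: subalgebra_def)

lemma gen_alg_Const: "Const c \<in> gen_alg n"
  and gen_alg_add: "p \<in> gen_alg n \<Longrightarrow> q \<in> gen_alg n \<Longrightarrow> p + q \<in> gen_alg n"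
  and gen_alg_mult: "p \<in> gen_alg n \<Longrightarrow> q \<in> gen_alg n \<Longrightarrow> p * q \<in> gen_alg n"
  using subalgebra_gen_alg[of n] unfolding subalgebra_def by blast+

lemma gen_alg_0: "0 \<in> gen_alg n"
  using gen_alg_Const[of 0 n] by simp

lemma gen_alg_power: "p \<in> gen_alg n \<Longrightarrow> p ^ k \<in> gen_alg n"
  by (induction k) (use gen_alg_Const[of 1 n] gen_alg_mult in auto)

lemma gen_alg_diff: "p \<in> gen_alg n \<Longrightarrow> q \<in> gen_alg n \<Longrightarrow> p - q \<in> gen_alg n"
  using gen_alg_add[of p n "Const (- 1) * q"] gen_alg_mult[OF gen_alg_Const[of "- 1"], of q n]
  by (simp add: Const_uminus)

lemma gens_subset_gen_alg: "vec_gens n \<subseteq> gen_alg n" "inv_gens n \<subseteq> gen_alg n"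
  unfolding gen_alg_def by (rule order_trans[OF _ hull_subset], simp add: gens_eq)+

lemma gen_alg_gens:
  "1 \<le> i \<Longrightarrow> i \<le> n \<Longrightarrow> Var (X i) \<in> gen_alg n"
  "1 \<le> i \<Longrightarrow> i < j \<Longrightarrow> j \<le> n \<Longrightarrow> J i j \<in> gen_alg n"
  "1 \<le> i \<Longrightarrow> i \<le> j \<Longrightarrow> j \<le> n \<Longrightarrow> H i j \<in> gen_alg n"
  "1 \<le> i \<Longrightarrow> i < j \<Longrightarrow> j < k \<Longrightarrow> k \<le> n \<Longrightarrow> Delta i j k \<in> gen_alg n"
  by (rule subsetD[OF gens_subset_gen_alg(1)], unfold vec_gens_def, blast)+
     (rule subsetD[OF gens_subset_gen_alg(2)], unfold inv_gens_def, blast)+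

lemma gen_alg_mono: "gen_alg n \<subseteq> (gen_alg (Suc n) :: 'k::comm_ring_1 mpoly set)"
  unfolding gen_alg_def
proof (rule hull_mono)
  show "gens n \<subseteq> (gens (Suc n) :: 'k mpoly set)"
    unfolding gens_def by (intro Un_mono Collect_mono) (blast intro: le_SucI)+
qed

lemma J_eq: "J i j = Var (X i) * Var (Y j) - Var (X j) * Var (Y i)"
  by (simp add: J_def det_2)

lemma Delta_eq: "Delta i j k =
  Var (X i) * Var (Y j) * Var (Z k) + Var (X j) * Var (Y k) * Var (Z i) +
  Var (X k) * Var (Y i) * Var (Z j) - Var (X i) * Var (Y k) * Var (Z j) -
  Var (X j) * Var (Y i) * Var (Z k) - Var (X k) * Var (Y j) * Var (Z i)"
  by (simp add: Delta_def det_3)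

lemmas Dop_rules = deriv_add[OF deriv_Dop] deriv_diff[OF deriv_Dop] deriv_mult[OF deriv_Dop]

lemma Dop_gens:
  assumes "finite I" "i \<in> I" "j \<in> I"
  shows "Dop I (J i j) = 0" "Dop I (H i j) = 0" "k \<in> I \<Longrightarrow> Dop I (Delta i j k) = 0"
  using assms by (simp_all add: J_eq H_def Delta_eq Dop_rules Dop_Var algebra_simps)

text \<open>The easy inclusion: the kernel is a subalgebra, so it suffices to test the
  generators.\<close>

lemma gen_alg_kernel: "p \<in> gen_alg n \<Longrightarrow> Dop {1..n} p = 0"
  unfolding gen_alg_def
proof (erule hull_induct)
  fix p :: "'a mpoly"
  assume "p \<in> gens n"
  then show "Dop {1..n} p = 0"
    unfolding gens_def by (auto simp: Dop_gens Dop_Var)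
qed (simp add: subalgebra_def Dop_rules deriv_Const[OF deriv_Dop])

lemma diff_in_poly_algebra:
  fixes p q :: "'k::comm_ring_1 mpoly"
  assumes "p \<in> poly_algebra n" "q \<in> poly_algebra n"
  shows "p - q \<in> poly_algebra n"
  using add_in_poly_algebra[OF assms(1) mult_in_poly_algebra[OF Const_in_poly_algebra[of "- 1"] assms(2)]]
  by (simp add: Const_uminus)

lemma gen_alg_poly_algebra: "gen_alg n \<subseteq> poly_algebra n"
  unfolding gen_alg_def
proof (rule hull_minimal, rule subsetI)
  have V: "Var (X i) \<in> poly_algebra n" "Var (Y i) \<in> poly_algebra n" "Var (Z i) \<in> poly_algebra n"
    if "1 \<le> i" "i \<le> n" for i
    by (rule Var_in_poly_algebra, use that in \<open>simp add: pvars_upto_def\<close>)+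
  fix p :: "'a mpoly"
  assume "p \<in> gens n"
  then show "p \<in> poly_algebra n"
    unfolding gens_def J_eq H_def Delta_eq
    by (auto intro!: V add_in_poly_algebra diff_in_poly_algebra mult_in_poly_algebra)
qed (rule subalgebra_poly_algebra)

lemma Dop_poly_algebra_outside:
  assumes "p \<in> poly_algebra n"
  shows "Dop {Suc n} p = 0"
proof -
  have "\<forall>m\<in>Poly_Mapping.keys p. Poly_Mapping.keys m \<subseteq> pvars_upto n"
    using assms by (simp add: poly_algebra_def)
  then show ?thesis
    by (induction p rule: mpoly_generated)
       (auto simp: Dop_rules deriv_Const[OF deriv_Dop] pvars_upto_def Dop_Var)
qed

text \<open>The index \<open>e\<close> counts the factors of the types \<open>x\<^sub>i\<close> and \<open>J\<^sub>i\<^sub>j\<close>, the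
  generators of weight 1; the others have weight 0.\<close>

inductive gen_prod :: "nat \<Rightarrow> nat \<Rightarrow> 'k::comm_ring_1 mpoly \<Rightarrow> bool" for n where
  Const: "gen_prod n 0 (Const c)"
| Inv: "gen_prod n e p \<Longrightarrow> q \<in> inv_gens n \<Longrightarrow> gen_prod n e (q * p)"
| Vec: "gen_prod n e p \<Longrightarrow> q \<in> vec_gens n \<Longrightarrow> gen_prod n (Suc e) (q * p)"

text \<open>Closure under sums suffices for the linear span, since products may carry an arbitrary
  constant factor.\<close>

inductive gen_span :: "nat \<Rightarrow> 'k::comm_ring_1 mpoly \<Rightarrow> bool" for n where
  base: "gen_prod n e p \<Longrightarrow> gen_span n p"
| add: "gen_span n p \<Longrightarrow> gen_span n q \<Longrightarrow> gen_span n (p + q)"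

lemma gen_prod_mult: "gen_prod n e p \<Longrightarrow> gen_prod n e' q \<Longrightarrow> gen_prod n (e + e') (p * q)"
proof (induction rule: gen_prod.induct)
  case (Const c)
  from Const show ?case
  proof (induction rule: gen_prod.induct)
    case (Const d)
    show ?case using gen_prod.Const[of n "c * d"] by (simp add: Const_mult)
  next
    case (Inv e p q)
    then show ?case using gen_prod.Inv[of n e "Const c * p" q] by (simp add: mult.left_commute)
  next
    case (Vec e p q)
    then show ?case using gen_prod.Vec[of n e "Const c * p" q] by (simp add: mult.left_commute)
  qed
next
  case (Inv e p q')
  then show ?case using gen_prod.Inv[of n "e + e'" "p * q" q'] by (simp add: mult.assoc)
next
  case (Vec e p q')
  then show ?case using gen_prod.Vec[of n "e + e'" "p * q" q'] by (simp add: mult.assoc)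
qed

lemma gen_prod_span_mult: "gen_span n q \<Longrightarrow> gen_prod n e p \<Longrightarrow> gen_span n (p * q)"
  by (induction rule: gen_span.induct)
     (auto intro: gen_span.intros gen_prod_mult simp: distrib_left)

lemma gen_span_mult: "gen_span n p \<Longrightarrow> gen_span n q \<Longrightarrow> gen_span n (p * q)"
  by (induction rule: gen_span.induct)
     (auto intro: gen_span.intros gen_prod_span_mult simp: distrib_right)

lemma gen_alg_span:
  assumes "p \<in> gen_alg n"
  shows "gen_span n p"
  using assms unfolding gen_alg_def
proof (rule hull_induct)
  fix p :: "'a mpoly"
  assume "p \<in> gens n"
  \<comment> \<open>A generator is a product with one factor over the constant 1; the index is 0 or
    1 according to its type.\<close>
  then have "gen_prod n 0 (p * Const 1) \<or> gen_prod n (Suc 0) (p * Const 1)"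
    unfolding gens_eq by (auto intro: gen_prod.intros simp del: Const_1)
  then show "gen_span n p"
    by (auto intro: gen_span.base)
next
  show "subalgebra {p. gen_span n p}"
    unfolding subalgebra_def by (auto intro: gen_span.intros gen_prod.Const gen_span_mult)
qed

section \<open>Weights of products of generators\<close>

lemma homog_add: "homog I w p \<Longrightarrow> homog I w q \<Longrightarrow> homog I w (p + q :: 'k::comm_ring_1 mpoly)"
  unfolding homog_def using keys_add[of p q] by blast

lemma homog_mult:
  fixes p q :: "'k::field_char_0 mpoly"
  shows "homog I v p \<Longrightarrow> homog I w q \<Longrightarrow> homog I (v + w) (p * q)"
  by (simp add: homog_iff_Hop deriv_mult[OF deriv_Hop] Const_add algebra_simps)

lemma homog_Var:
  assumes "finite I" "i \<in> I"
  shows "homog I 1 (Var (X i) :: 'k::field_char_0 mpoly)" "homog I 0 (Var (Y i) :: 'k mpoly)"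
    "homog I (- 1) (Var (Z i) :: 'k mpoly)"
  using assms by (simp_all add: homog_iff_Hop Hop_Var Const_uminus)

lemma homog_gens:
  assumes "finite I" "i \<in> I" "j \<in> I"
  shows "homog I 1 (J i j :: 'k::field_char_0 mpoly)" "homog I 0 (H i j :: 'k mpoly)"
    "k \<in> I \<Longrightarrow> homog I 0 (Delta i j k :: 'k mpoly)"
proof -
  note V = homog_Var[where 'k = 'k, OF assms(1)]
  note m = homog_mult[where 'k = 'k and I = I]
  show "homog I 1 (J i j :: 'k mpoly)"
    unfolding J_eq using m[OF V(1) V(2)] assms by (intro homog_diff) simp_all
  show "homog I 0 (H i j :: 'k mpoly)"
    unfolding H_def using m[OF V(1) V(3)] m[OF V(3) V(1)] m[OF V(2) V(2)] assms
    by (intro homog_add homog_diff) simp_all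
  show "homog I 0 (Delta i j k :: 'k mpoly)" if "k \<in> I"
    unfolding Delta_eq using m[OF m[OF V(1) V(2)] V(3)] assms that
    by (intro homog_add homog_diff) simp_all
qed

text \<open>This turns a lower bound on weight into a lower bound on the number of factors from
  \<open>vec_gens\<close>.\<close>

lemma gen_prod_homog:
  fixes p :: "'k::field_char_0 mpoly"
  shows "gen_prod n e p \<Longrightarrow> homog {1..n} (int e) p"
proof (induction rule: gen_prod.induct)
  case (Const c)
  show ?case by (simp add: homog_iff_Hop deriv_Const[OF deriv_Hop])
next
  case (Inv e p q)
  then have "homog {1..n} 0 q" by (auto simp: inv_gens_def intro!: homog_gens)
  from homog_mult[OF this Inv.IH] show ?case by simp
next
  case (Vec e p q)
  then have "homog {1..n} 1 q" by (auto simp: vec_gens_def intro!: homog_gens homog_Var)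
  from homog_mult[OF this Vec.IH] show ?case by simp
qed

section \<open>Lifting leading terms\<close>

text \<open>\<open>g\<close> is the last nonzero \<open>Dop {Suc n}\<close>-derivative of an element
  of the algebra, or zero. Requiring the next derivative to vanish makes lifts
  multiplicative.\<close>

definition lifts :: "nat \<Rightarrow> nat \<Rightarrow> 'k::comm_ring_1 mpoly \<Rightarrow> bool" where
  "lifts n j g \<longleftrightarrow> (\<exists>a\<in>gen_alg (Suc n). (Dop {Suc n} ^^ Suc j) a = 0 \<and> (Dop {Suc n} ^^ j) a = g)"

lemma lifts_add: "lifts n j g \<Longrightarrow> lifts n j h \<Longrightarrow> lifts n j (g + h)"
  unfolding lifts_def
  by (metis (no_types, lifting) deriv_iter_add[OF deriv_Dop] gen_alg_add add.right_neutral)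

lemma lifts_zero: "lifts n j 0"
  unfolding lifts_def
  by (intro bexI[of _ 0] conjI deriv_iter_zero[OF deriv_Dop] gen_alg_0)

lemma lifts_sum: "(\<And>i. i \<in> I \<Longrightarrow> lifts n j (f i)) \<Longrightarrow> lifts n j (\<Sum>i\<in>I. f i)"
  by (induction I rule: infinite_finite_induct) (simp_all add: lifts_zero lifts_add)

lemma lifts_mult_const:
  assumes "c \<in> gen_alg (Suc n)" "Dop {Suc n} c = 0" "lifts n j g"
  shows "lifts n j (c * g)"
proof -
  from assms(3) obtain a where a: "a \<in> gen_alg (Suc n)" "(Dop {Suc n} ^^ Suc j) a = 0"
    "(Dop {Suc n} ^^ j) a = g"
    unfolding lifts_def by blast
  show ?thesis
    unfolding lifts_def
    using assms(1) a deriv_iter_mult_const[OF deriv_Dop assms(2), of _ a]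
    by (intro bexI[of _ "c * a"]) (auto intro: gen_alg_mult simp del: funpow.simps)
qed

text \<open>The product of two lifts has top derivative \<open>g * h\<close> times a binomial
  coefficient, which is invertible in characteristic 0.\<close>

lemma lifts_mult:
  fixes g h :: "'k::field_char_0 mpoly"
  assumes "lifts n i g" "lifts n j h"
  shows "lifts n (i + j) (g * h)"
proof -
  let ?d = "Dop {Suc n}"
  from assms obtain a b where a: "a \<in> gen_alg (Suc n)" "(?d ^^ Suc i) a = 0" "(?d ^^ i) a = g"
    and b: "b \<in> gen_alg (Suc n)" "(?d ^^ Suc j) b = 0" "(?d ^^ j) b = h"
    unfolding lifts_def by blast
  let ?c = "of_nat ((i + j) choose i) :: 'k"
  note L = deriv_iter_Leibniz_top[OF deriv_Dop a(2) b(2)]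
  have "(?d ^^ (i + j)) (Const (inverse ?c) * (a * b)) = Const (inverse ?c * ?c) * (g * h)"
    unfolding deriv_iter_scale[OF deriv_Dop] L(2) a(3) b(3) Const_mult
    by (simp add: of_nat_eq_Const mult.assoc)
  also have "\<dots> = g * h" by simp
  finally have "(?d ^^ (i + j)) (Const (inverse ?c) * (a * b)) = g * h" .
  moreover have "(?d ^^ Suc (i + j)) (Const (inverse ?c) * (a * b)) = 0"
    unfolding deriv_iter_scale[OF deriv_Dop] L(1) by simp
  ultimately show ?thesis
    unfolding lifts_def using a(1) b(1)
    by (intro bexI[of _ "Const (inverse ?c) * (a * b)"]) (auto intro: gen_alg_mult gen_alg_Const)
qed

lemma lifts_vector:
  assumes "q \<in> vec_gens n"
  shows "lifts n 0 q" "lifts n 1 (Var (X (Suc n)) * q)" "lifts n 2 (Var (X (Suc n)) * q)"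
proof -
  have q: "q \<in> gen_alg n"
    using assms gens_subset_gen_alg(1) by blast
  have dq: "Dop {Suc n} q = 0"
    using q gen_alg_poly_algebra Dop_poly_algebra_outside by blast
  show "lifts n 0 q"
    unfolding lifts_def using q dq gen_alg_mono by (intro bexI[of _ q]) auto
  have "\<exists>h\<in>gen_alg (Suc n). Dop {Suc n} (Dop {Suc n} h) = Var (X (Suc n)) * q"
    and "\<exists>k\<in>gen_alg (Suc n). Dop {Suc n} k = Var (X (Suc n)) * q"
    using assms
    unfolding vec_gens_def
  proof (atomize (full), elim UnE CollectE exE conjE)
    fix i assume i: "q = Var (X i)" "1 \<le> i" "i \<le> n"
    show "(\<exists>h\<in>gen_alg (Suc n). Dop {Suc n} (Dop {Suc n} h) = Var (X (Suc n)) * q) \<and>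
      (\<exists>k\<in>gen_alg (Suc n). Dop {Suc n} k = Var (X (Suc n)) * q)"
    proof (intro conjI bexI)
      \<comment> \<open>With \<open>x, y, z\<close> the last triple,
        \<open>d H = x_i y - y_i x\<close>, so \<open>d^2 H = x x_i\<close>, while
        \<open>d J = x x_i\<close> at once.\<close>
      show "H i (Suc n) \<in> gen_alg (Suc n)" "J i (Suc n) \<in> gen_alg (Suc n)"
        using i by (auto intro: gen_alg_gens[simplified])
      show "Dop {Suc n} (Dop {Suc n} (H i (Suc n))) = Var (X (Suc n)) * q"
        "Dop {Suc n} (J i (Suc n)) = Var (X (Suc n)) * q"
        unfolding i(1) using i(2-) by (simp_all add: H_def J_eq Dop_rules Dop_Var algebra_simps)
    qed
  next
    fix i j assume i: "q = J i j" "1 \<le> i" "i < j" "j \<le> n"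
    show "(\<exists>h\<in>gen_alg (Suc n). Dop {Suc n} (Dop {Suc n} h) = Var (X (Suc n)) * q) \<and>
      (\<exists>k\<in>gen_alg (Suc n). Dop {Suc n} k = Var (X (Suc n)) * q)"
    proof (intro conjI bexI)
      \<comment> \<open>In \<open>Delta\<close> the coefficient of the last \<open>z\<close> is
        \<open>J i j\<close>, and \<open>d^2\<close> turns that \<open>z\<close> into
        \<open>x\<close>. In the second witness the terms with the last \<open>y\<close> cancel
        after one derivation, leaving \<open>x * J i j\<close>.\<close>
      show "Delta i j (Suc n) \<in> gen_alg (Suc n)"
        "Var (X j) * H i (Suc n) - Var (X i) * H j (Suc n) \<in> gen_alg (Suc n)"
        using i by (auto intro!: gen_alg_diff gen_alg_mult gen_alg_gens[simplified])
      show "Dop {Suc n} (Dop {Suc n} (Delta i j (Suc n))) = Var (X (Suc n)) * q"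
        "Dop {Suc n} (Var (X j) * H i (Suc n) - Var (X i) * H j (Suc n)) = Var (X (Suc n)) * q"
        unfolding i(1) using i(2-) by (simp_all add: H_def J_eq Delta_eq Dop_rules Dop_Var algebra_simps)
    qed
  qed
  then obtain h k where hk: "h \<in> gen_alg (Suc n)" "Dop {Suc n} (Dop {Suc n} h) = Var (X (Suc n)) * q"
      "k \<in> gen_alg (Suc n)" "Dop {Suc n} k = Var (X (Suc n)) * q"
    by blast
  have d: "Dop {Suc n} (Var (X (Suc n)) * q) = 0"
    by (simp add: Dop_rules Dop_Var dq)
  show "lifts n 1 (Var (X (Suc n)) * q)"
    unfolding lifts_def using hk d by (intro bexI[of _ k]) simp_all
  show "lifts n 2 (Var (X (Suc n)) * q)"
    unfolding lifts_def using hk d by (intro bexI[of _ h]) (simp_all add: numeral_2_eq_2)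
qed

text \<open>\<open>(j + 1) div 2\<close> is \<open>j/2\<close> rounded up. Each factor from
  \<open>vec_gens\<close> paired with one \<open>x\<close> accounts for two derivations, or for one
  if only one remains; any further factors are lifted to order 0 without an
  \<open>x\<close>.\<close>

lemma lifts_gen_prod:
  fixes p :: "'k::field_char_0 mpoly"
  assumes "gen_prod n e p" "(j + 1) div 2 \<le> e"
  shows "lifts n j (Var (X (Suc n)) ^ ((j + 1) div 2) * p)"
  using assms
proof (induction arbitrary: j rule: gen_prod.induct)
  case (Const c)
  then have "j = 0" by simp
  then show ?case
    using gen_alg_Const[of c "Suc n"]
    by (auto simp: lifts_def deriv_Const[OF deriv_Dop])
next
  case (Inv e p q)
  have q: "q \<in> gen_alg n"
    using Inv.hyps(2) gens_subset_gen_alg(2) by blast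
  then have "Dop {Suc n} q = 0"
    using gen_alg_poly_algebra Dop_poly_algebra_outside by blast
  with q have "lifts n j (q * (Var (X (Suc n)) ^ ((j + 1) div 2) * p))"
    using gen_alg_mono Inv.IH[OF Inv.prems] by (blast intro: lifts_mult_const)
  then show ?case by (simp only: mult.left_commute)
next
  case (Vec e p q)
  note q = lifts_vector[OF Vec.hyps(2)]
  consider "j = 0" | "j = 1" | l where "j = 2 + l"
    by (metis One_nat_def add_2_eq_Suc not0_implies_Suc)
  then show ?case
  proof cases
    case 1
    with lifts_mult[OF q(1) Vec.IH[of 0]] show ?thesis by simp
  next
    case 2
    with lifts_mult[OF q(2) Vec.IH[of 0]] show ?thesis by (simp add: mult.assoc)
  next
    case 3
    with Vec.prems have "(l + 1) div 2 \<le> e" by simp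
    from lifts_mult[OF q(3) Vec.IH[OF this]] 3 show ?thesis by (simp add: ac_simps)
  qed
qed

text \<open>A decomposition of \<open>r\<close> into products may contain terms of too small weight
  that cancel in the sum. Applying \<open>filt\<close> to each term discards them and keeps products
  with at least \<open>j/2\<close> factors from \<open>vec_gens\<close>.\<close>

lemma lifts_filt:
  fixes r :: "'k::field_char_0 mpoly"
  assumes "gen_span n r" "j \<le> 2 * i"
  shows "lifts n j (Var (X (Suc n)) ^ i * (H (Suc n) (Suc n) ^ k * filt {1..n} {w. int j \<le> 2 * w} r))"
  using assms(1)
proof (induction rule: gen_span.induct)
  case (base e p)
  show ?case
  proof (cases "j \<le> 2 * e")
    case True
    let ?x = "Var (X (Suc n)) :: 'k mpoly" and ?Q = "H (Suc n) (Suc n) :: 'k mpoly" and ?l = "(j + 1) div 2"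
    \<comment> \<open>The powers of \<open>x\<close> beyond the \<open>?l\<close> used for lifting,
      and those of \<open>Q\<close>, are constants for the derivation.\<close>
    have "lifts n j (?x ^ (i - ?l) * ?Q ^ k * (?x ^ ?l * p))"
    proof (rule lifts_mult_const)
      show "?x ^ (i - ?l) * ?Q ^ k \<in> gen_alg (Suc n)"
        by (intro gen_alg_mult gen_alg_power gen_alg_gens) simp_all
      show "Dop {Suc n} (?x ^ (i - ?l) * ?Q ^ k) = 0"
        by (simp add: Dop_rules deriv_power_zero[OF deriv_Dop] Dop_H_diag Dop_Var)
      show "lifts n j (?x ^ ?l * p)"
        using True by (intro lifts_gen_prod[OF base]) simp
    qed
    moreover have "?x ^ (i - ?l) * ?Q ^ k * (?x ^ ?l * p) = ?x ^ (i - ?l + ?l) * (?Q ^ k * p)"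
      by (simp add: power_add ac_simps)
    moreover have "i - ?l + ?l = i" using assms(2) by simp
    moreover have "filt {1..n} {w. int j \<le> 2 * w} p = p"
      using True filt_homog[OF _ gen_prod_homog[OF base]] by simp
    ultimately show ?thesis by simp
  next
    case False
    then have "filt {1..n} {w. int j \<le> 2 * w} p = 0"
      using filt_homog[OF _ gen_prod_homog[OF base]] by simp
    then show ?thesis by (simp add: lifts_zero)
  qed
next
  case (add p q)
  from lifts_add[OF add.IH] show ?case
    by (simp add: filt_add distrib_left)
qed

section \<open>The kernel\<close>

lemma lookup_coeff3:
  "Poly_Mapping.lookup (coeff3 a i j k p) m =
    (if Poly_Mapping.lookup m (X a) = 0 \<and> Poly_Mapping.lookup m (Y a) = 0 \<and> Poly_Mapping.lookup m (Z a) = 0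
     then Poly_Mapping.lookup p (m + Poly_Mapping.single (X a) i + Poly_Mapping.single (Y a) j +
       Poly_Mapping.single (Z a) k) else 0)"
  by (auto simp: coeff3_def lookup_cf lookup_add lookup_single_not_eq)

lemma coeff3_in_poly_algebra:
  assumes "p \<in> poly_algebra (Suc n)"
  shows "coeff3 (Suc n) i j k p \<in> poly_algebra n"
  unfolding poly_algebra_def
proof safe
  fix m v
  assume m: "m \<in> Poly_Mapping.keys (coeff3 (Suc n) i j k p)" and v: "v \<in> Poly_Mapping.keys m"
  let ?m = "m + Poly_Mapping.single (X (Suc n)) i + Poly_Mapping.single (Y (Suc n)) j +
       Poly_Mapping.single (Z (Suc n)) k"
  have 0: "Poly_Mapping.lookup m (X (Suc n)) = 0" "Poly_Mapping.lookup m (Y (Suc n)) = 0"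
    "Poly_Mapping.lookup m (Z (Suc n)) = 0" and "?m \<in> Poly_Mapping.keys p"
    using m by (auto simp: in_keys_iff lookup_coeff3 split: if_splits)
  moreover have "v \<in> Poly_Mapping.keys ?m"
    using v by (simp add: in_keys_iff lookup_add)
  ultimately have "v \<in> pvars_upto (Suc n)"
    using assms unfolding poly_algebra_def by blast
  moreover have "v \<noteq> X (Suc n)" "v \<noteq> Y (Suc n)" "v \<noteq> Z (Suc n)"
    using 0 v by (auto simp: in_keys_iff)
  ultimately show "v \<in> pvars_upto n"
    by (auto simp: pvars_upto_def le_Suc_eq)
qed

lemma Dop_in_poly_algebra:
  assumes "p \<in> poly_algebra n" "I \<subseteq> {1..n}"
  shows "Dop I p \<in> poly_algebra n"
  unfolding Dop_def using assms
  by (intro sum_in_poly_algebra add_in_poly_algebra mult_in_poly_algebra pd_in_poly_algebra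
      Var_in_poly_algebra) (auto simp: pvars_upto_def)

lemma Dop_iter_in_poly_algebra:
  "p \<in> poly_algebra n \<Longrightarrow> I \<subseteq> {1..n} \<Longrightarrow> (Dop I ^^ j) p \<in> poly_algebra n"
  by (induction j) (simp_all add: Dop_in_poly_algebra)

lemma Dop_iter_commute:
  "finite I \<Longrightarrow> finite K \<Longrightarrow> (Dop I ^^ j) (Dop K p) = Dop K ((Dop I ^^ j) p)"
  by (induction j) (simp_all add: Dop_commute)

text \<open>The leading derivative of a kernel element is also reached from the algebra. Being an
  iterated derivative for both \<open>?d\<close> and, up to sign, \<open>?R\<close>, it satisfies
  the weight bound on both groups of variables.\<close>

lemma kernel_lifts:
  fixes f :: "'k::field_char_0 mpoly"
  assumes IH: "\<And>p :: 'k mpoly. p \<in> poly_algebra n \<Longrightarrow> Dop {1..n} p = 0 \<Longrightarrow> p \<in> gen_alg n"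
    and f: "f \<in> poly_algebra (Suc n)" "Dop {1..Suc n} f = 0" "(Dop {Suc n} ^^ Suc j) f = 0"
  shows "lifts n j ((Dop {Suc n} ^^ j) f)"
proof -
  let ?d = "Dop {Suc n} :: 'k mpoly \<Rightarrow> _" and ?R = "Dop {1..n} :: 'k mpoly \<Rightarrow> _"
  define g where "g = (?d ^^ j) f"
  have "{1..Suc n} = {1..n} \<union> {Suc n}" by auto
  then have df: "?d f = - ?R f"
    using f(2) Dop_Un[of "{1..n}" "{Suc n}" f] by (simp add: add_eq_0_iff)
  \<comment> \<open>Because \<open>?d\<close> and \<open>?R\<close> commute,
    \<open>?d f = - ?R f\<close> can be iterated.\<close>
  have dR: "(?d ^^ l) f = Const ((- 1) ^ l) * (?R ^^ l) f" for l
  proof (induction l)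
    case (Suc l)
    have "(?d ^^ Suc l) f = Const ((- 1) ^ l) * ?d ((?R ^^ l) f)"
      using Suc by (simp add: deriv_scale[OF deriv_Dop])
    also have "?d ((?R ^^ l) f) = - (?R ^^ Suc l) f"
    proof -
      have "?d ((?R ^^ l) f) = (?R ^^ l) (?d f)"
        by (rule Dop_iter_commute[symmetric]) simp_all
      also have "\<dots> = - (?R ^^ Suc l) f"
        unfolding df deriv_iter_uminus[OF deriv_Dop] by (simp add: funpow_swap1)
      finally show ?thesis .
    qed
    finally show ?case by (simp add: Const_uminus)
  qed simp
  have sgn: "Const ((- 1) ^ l) * q = 0 \<longleftrightarrow> q = 0" for l and q :: "'k mpoly"
    by (simp add: Const_mult_eq_0_iff)
  have R0: "(?R ^^ Suc j) f = 0"
    using f(3) dR[of "Suc j"] sgn by metis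
  have "?d g = 0" using f(3) by (simp add: g_def)
  then obtain M where M: "g = (\<Sum>i\<le>M. \<Sum>k\<le>M. Const ((- 1) ^ k) *
    (Var (X (Suc n)) ^ i * (H (Suc n) (Suc n) ^ k * coeff3 (Suc n) i (2 * k) 0 g)))"
    by (rule Dop_kernel_expansion)
  have "lifts n j (Const ((- 1) ^ k) *
    (Var (X (Suc n)) ^ i * (H (Suc n) (Suc n) ^ k * coeff3 (Suc n) i (2 * k) 0 g)))" for i k
  proof -
    define r where "r = coeff3 (Suc n) i (2 * k) 0 g"
    \<comment> \<open>A monomial of \<open>r\<close> is completed to the monomial \<open>?m\<close>
      of \<open>g\<close>. The bound for \<open>?d\<close> reads off the exponent \<open>i\<close>
      of \<open>x\<close>, as \<open>y\<close> has weight 0 and \<open>z\<close> is absent; the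
      bound for \<open>?R\<close> controls the remaining variables.\<close>
    have weights: "j \<le> 2 * i \<and> int j \<le> 2 * weight {1..n} m" if "Poly_Mapping.lookup r m \<noteq> 0" for m
    proof -
      let ?m = "m + Poly_Mapping.single (X (Suc n)) i + Poly_Mapping.single (Y (Suc n)) (2 * k) +
        Poly_Mapping.single (Z (Suc n)) 0"
      from that have m: "Poly_Mapping.lookup m (X (Suc n)) = 0" "Poly_Mapping.lookup m (Z (Suc n)) = 0"
        and "Poly_Mapping.lookup g ?m \<noteq> 0"
        by (auto simp: r_def lookup_coeff3 split: if_splits)
      then have "Poly_Mapping.lookup ((?d ^^ j) f) ?m \<noteq> 0" "Poly_Mapping.lookup ((?R ^^ j) f) ?m \<noteq> 0"
        by (auto simp: g_def dR lookup_Const_mult)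
      then have "\<not> 2 * weight {Suc n} ?m < int j" "\<not> 2 * weight {1..n} ?m < int j"
        using Dop_image_kernel_weight[OF _ f(3), of ?m] Dop_image_kernel_weight[OF _ R0, of ?m]
        by auto
      moreover have "weight {Suc n} ?m = int i"
        using m by (simp add: weight_def lookup_add lookup_single)
      moreover have "weight {1..n} ?m = weight {1..n} m"
        unfolding weight_def by (intro sum.cong) (auto simp: lookup_add lookup_single)
      ultimately show ?thesis by linarith
    qed
    have "r \<in> poly_algebra n"
      unfolding r_def g_def using f(1) by (intro coeff3_in_poly_algebra Dop_iter_in_poly_algebra) auto
    moreover have "?R r = 0"
    proof -
      have "?R g = 0"
        using R0 by (simp add: g_def dR deriv_scale[OF deriv_Dop])
      moreover have "?R r = coeff3 (Suc n) i (2 * k) 0 (?R g)"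
        by (simp add: r_def coeff3_def cf_Dop[where a = "Suc n"])
      ultimately show ?thesis by (simp add: coeff3_def)
    qed
    ultimately have "gen_span n r"
      by (intro gen_alg_span IH)
    show ?thesis
    proof (cases "r = 0")
      case True
      then show ?thesis by (simp add: r_def[symmetric] lifts_zero)
    next
      case False
      then have "j \<le> 2 * i"
        using weights by (metis lookup_zero poly_mapping_eqI)
      \<comment> \<open>All weights in \<open>r\<close> satisfy the bound, so filtering its
        decomposition does not change the sum.\<close>
      have filt_r: "filt {1..n} {w. int j \<le> 2 * w} r = r"
        by (rule poly_mapping_eqI) (use weights in \<open>auto simp: lookup_filt\<close>)
      show ?thesis
        using lifts_filt[OF \<open>gen_span n r\<close> \<open>j \<le> 2 * i\<close>, of k]
        unfolding filt_r r_def[symmetric]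
        by (rule lifts_mult_const[OF gen_alg_Const deriv_Const[OF deriv_Dop]])
    qed
  qed
  then show ?thesis
    unfolding g_def[symmetric] by (subst M, intro lifts_sum)
qed

text \<open>The outer induction is on the number of triples, the inner one on the order of
  nilpotency of \<open>f\<close> under the derivation of the last triple.\<close>

lemma kernel_in_gen_alg:
  fixes f :: "'k::field_char_0 mpoly"
  assumes "f \<in> poly_algebra n" "Dop {1..n} f = 0"
  shows "f \<in> gen_alg n"
  using assms
proof (induction n arbitrary: f)
  case 0
  \<comment> \<open>Without variables only constants remain.\<close>
  then have "\<forall>m\<in>Poly_Mapping.keys f. Poly_Mapping.keys m \<subseteq> {}"
    by (auto simp: poly_algebra_def pvars_upto_def)
  then show ?case
    by (induction f rule: mpoly_generated) (auto intro: gen_alg_Const gen_alg_add gen_alg_mult)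
next
  case (Suc n)
  have "f \<in> gen_alg (Suc n)" if "(Dop {Suc n} ^^ j) f = 0" for j
    using that Suc.prems
  proof (induction j arbitrary: f)
    case 0
    then show ?case by (simp add: gen_alg_0)
  next
    case (Suc j)
    from kernel_lifts[OF \<open>\<And>f. f \<in> poly_algebra n \<Longrightarrow> Dop {1..n} f = 0 \<Longrightarrow> f \<in> gen_alg n\<close> Suc.prems(2,3,1)]
    obtain a where a: "a \<in> gen_alg (Suc n)" "(Dop {Suc n} ^^ j) a = (Dop {Suc n} ^^ j) f"
      unfolding lifts_def by blast
    \<comment> \<open>Subtracting the lift lowers the nilpotency order and stays in the kernel,
      since \<open>a\<close> lies in the algebra.\<close>
    have "f - a \<in> gen_alg (Suc n)"
    proof (rule Suc.IH)
      show "(Dop {Suc n} ^^ j) (f - a) = 0"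
        by (simp add: deriv_iter_diff[OF deriv_Dop] a)
      show "f - a \<in> poly_algebra (Suc n)"
        using a(1) gen_alg_poly_algebra Suc.prems(2) by (blast intro: diff_in_poly_algebra)
      show "Dop {1..Suc n} (f - a) = 0"
        using Suc.prems(3) gen_alg_kernel[OF a(1)] by (simp add: deriv_diff[OF deriv_Dop])
    qed
    from gen_alg_add[OF this a(1)] show ?case by simp
  qed
  moreover obtain j where "(Dop {Suc n} ^^ j) f = 0"
    using Dop_nilpotent[of "{Suc n}" f] by auto
  ultimately show ?case by blast
qed

theorem theorem3:
  fixes n :: nat and D :: "'k::field_char_0 mpoly \<Rightarrow> 'k mpoly"
  assumes "n \<ge> 1"
    and "derivation_on (poly_algebra n) D"
    and "\<And>i. i \<in> {1..n} \<Longrightarrow> D (Var (X i)) = 0"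
    and "\<And>i. i \<in> {1..n} \<Longrightarrow> D (Var (Y i)) = Var (X i)"
    and "\<And>i. i \<in> {1..n} \<Longrightarrow> D (Var (Z i)) = Var (Y i)"
  shows "kernel_on (poly_algebra n) D =
    subalgebra hull
      ({Var (X i) | i. 1 \<le> i \<and> i \<le> n} \<union>
       {J i j | i j. 1 \<le> i \<and> i < j \<and> j \<le> n} \<union>
       {H i j | i j. 1 \<le> i \<and> i \<le> j \<and> j \<le> n} \<union>
       {Delta i j k | i j k. 1 \<le> i \<and> i < j \<and> j < k \<and> k \<le> n})"
proof -
  \<comment> \<open>\<open>D\<close> is specified only on \<open>poly_algebra n\<close>, where it
    agrees with the global operator.\<close>
  have D: "D p = Dop {1..n} p" if "p \<in> poly_algebra n" for p
    using assms(2) deriv_Dop _ that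
  proof (rule derivation_on_poly_algebra_unique)
    fix v assume "v \<in> pvars_upto n"
    then show "D (Var v) = Dop {1..n} (Var v)"
      using assms(3-5) by (auto simp: pvars_upto_def Dop_Var)
  qed
  have "kernel_on (poly_algebra n) D = gen_alg n"
    using D kernel_in_gen_alg gen_alg_kernel gen_alg_poly_algebra
    by (fastforce simp: kernel_on_def)
  then show ?thesis
    unfolding gen_alg_def gens_def .
qed

end
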